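(* Let $X$ be a Banach space such that $\tilde{\varepsilon}_0^k(X)<2$ for some $k\in\mathbb{N}$. Then $X$ has the weak fixed point property for $\mathfrak{cm}$-nonexpansive maps: for every nonempty weakly compact convex $C\subset X$, every $\mathfrak{cm}$-nonexpansive map $T\colon C\to C$ has a fixed point.
   Context: For $k\in\mathbb{N}$, $s_k(X)$ is the supremum of the numbers $\varepsilon\in[0,2]$ for which there are $x_1,\dots,x_{k+1}\in B_X$ with $\min_{i\ne j}\|x_i-x_j\|\ge\varepsilon$. Define $\tilde\delta^k\colon[0,s_k(X))\to[0,1]$ by $\tilde\delta^k(\varepsilon)=\inf\{1-\|\frac1{k+1}\sum_{i=1}^{k+1}x_i\|:\ \{x_i\}_{i=1}^{k+1}\subset B_X,\ \min_{i\ne j}\|x_i-x_j\|\ge\varepsilon\}$, and $\tilde\varepsilon_0^k(X)=\sup\{\varepsilon\in[0,s_k(X)):\ \tilde\delta^k(\varepsilon)=0\}$. For a bounded convex set $C$, a nonexpansive map $T\colon C\to C$ is $\mathfrak{cm}$-nonexpansive if for all $n\in\mathbb{N}$, $y\in C$ and sequences $(u_i)_{i=1}^\infty\subset C$: $\limsup_{i\to\infty}\sup_{A\subset\{1,\dots,n\}}\|\sum_{k\in A}(Tu_{i+k}-Ty)\|\le\limsup_{i\to\infty}\sup_{A\subset\{1,\dots,n\}}\|\sum_{k\in A}(u_{i+k}-y)\|$. *)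

theory Defs
  imports "HOL-Analysis.Analysis"
begin

definition weak_topology :: "'a::real_normed_vector topology" where
  "weak_topology = topology_generated_by
     {f -` U | (f :: 'a \<Rightarrow> real) U. bounded_linear f \<and> open U}"

definition weakly_compact :: "'a::real_normed_vector set \<Rightarrow> bool" where
  "weakly_compact C \<longleftrightarrow> compactin weak_topology C"

definition sep_tuple :: "nat \<Rightarrow> real \<Rightarrow> (nat \<Rightarrow> 'a::real_normed_vector) \<Rightarrow> bool" where
  "sep_tuple k \<epsilon> x \<longleftrightarrow> (\<forall>i\<le>k. x i \<in> cball 0 1) \<and>
     (\<forall>i\<le>k. \<forall>j\<le>k. i \<noteq> j \<longrightarrow> \<epsilon> \<le> norm (x i - x j))"

definition s_k :: "'a::real_normed_vector itself \<Rightarrow> nat \<Rightarrow> real" where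
  "s_k TYPE('a) k = Sup {\<epsilon> \<in> {0..2}. \<exists>x :: nat \<Rightarrow> 'a. sep_tuple k \<epsilon> x}"

definition delta_k :: "'a::real_normed_vector itself \<Rightarrow> nat \<Rightarrow> real \<Rightarrow> real" where
  "delta_k TYPE('a) k \<epsilon> = Inf {1 - norm ((1 / real (k + 1)) *\<^sub>R (\<Sum>i\<le>k. x i)) | x :: nat \<Rightarrow> 'a.
      sep_tuple k \<epsilon> x}"

definition eps0_k :: "'a::real_normed_vector itself \<Rightarrow> nat \<Rightarrow> real" where
  "eps0_k TYPE('a) k = Sup {\<epsilon>. 0 \<le> \<epsilon> \<and> \<epsilon> < s_k TYPE('a) k \<and> delta_k TYPE('a) k \<epsilon> = 0}"

definition nonexpansive_on :: "'a::real_normed_vector set \<Rightarrow> ('a \<Rightarrow> 'a) \<Rightarrow> bool" where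
  "nonexpansive_on C T \<longleftrightarrow> T ` C \<subseteq> C \<and> (\<forall>x\<in>C. \<forall>y\<in>C. norm (T x - T y) \<le> norm (x - y))"

definition subset_sum_sup :: "nat \<Rightarrow> (nat \<Rightarrow> 'a::real_normed_vector) \<Rightarrow> 'a \<Rightarrow> nat \<Rightarrow> real" where
  "subset_sum_sup n v y i = Max ((\<lambda>A. norm (\<Sum>k\<in>A. v (i + k) - y)) ` Pow {1..n})"

definition cm_nonexpansive :: "'a::real_normed_vector set \<Rightarrow> ('a \<Rightarrow> 'a) \<Rightarrow> bool" where
  "cm_nonexpansive C T \<longleftrightarrow> nonexpansive_on C T \<and>
     (\<forall>n::nat. n \<ge> 1 \<longrightarrow> (\<forall>y\<in>C. \<forall>u :: nat \<Rightarrow> 'a. range u \<subseteq> C \<longrightarrow>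
        limsup (\<lambda>i. ereal (subset_sum_sup n (T \<circ> u) (T y) i))
          \<le> limsup (\<lambda>i. ereal (subset_sum_sup n u y i))))"

end

theory Submission
  imports Defs "HOL-Library.Diagonal_Subsequence" "HOL-Library.Ramsey"
begin

text \<open>
  Suppose the invariant set \<open>K\<close> is minimal and has diameter \<open>d > 0\<close>. The function sending \<open>y\<close> to the
  limsup over \<open>i\<close> of \<open>sup\<^sub>A norm (\<Sum>k\<in>A. u (i + k) - y)\<close> is convex, continuous and, for an approximate
  fixed point sequence \<open>u\<close>, not increased by \<open>T\<close>. By minimality it is constant on \<open>K\<close>, and since \<open>K\<close>
  is diametral the constant is \<open>n d\<close>. As in the Goebel-Karlovitz lemma this extends, for a fixed
  \<open>y = p\<close>, to sequences whose displacement under \<open>T\<close> is merely small.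

  Take an approximate fixed point sequence \<open>w\<close> with weak limit \<open>p\<close> and let \<open>z\<^sub>n\<close> be the fixed point
  of the contraction \<open>(1 - t) T + t (p + w\<^sub>n) / 2\<close>. Then the \<open>z\<^sub>n\<close> are nearly fixed, lie within
  \<open>d / 2\<close> of each other and asymptotically within \<open>d / 2\<close> of \<open>w\<^sub>n\<close>. Pass to a subsequence with weak
  limit \<open>q\<close> and put \<open>a\<^sub>j = 2 / d (z\<^sub>j - q)\<close> and \<open>b = 2 / d (q - p)\<close>: these vectors and the differences
  \<open>a\<^sub>i - a\<^sub>j\<close> lie in the unit ball, \<open>a\<close> is weakly null, and by Ramsey's theorem one may assume that
  all sums of \<open>k\<close> terms \<open>a\<^sub>j + b\<close> have norm almost \<open>2 k\<close>. Functionals norming such sums are almost \<open>1\<close>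
  on the terms involved and, by Ramsey's theorem again, almost at most \<open>0\<close> on the terms before and
  after them. Hence \<open>b\<close> and \<open>a\<^sub>k\<^sub>+\<^sub>s - a\<^sub>s\<close> (\<open>s < k\<close>) are \<open>k + 1\<close> points of the unit ball at mutual distance
  almost \<open>2\<close> whose average has norm almost \<open>1\<close>.
\<close>

section \<open>Hahn-Banach separation\<close>

definition sublinear :: "('a::real_vector \<Rightarrow> real) \<Rightarrow> bool" where
  "sublinear p \<longleftrightarrow> (\<forall>x y. p (x + y) \<le> p x + p y) \<and> (\<forall>c x. 0 \<le> c \<longrightarrow> p (c *\<^sub>R x) = c * p x)"

lemma sublinearI:
  fixes p :: "'a::real_vector \<Rightarrow> real"
  assumes add: "\<And>x y. p (x + y) \<le> p x + p y"
    and scale: "\<And>c x. 0 < c \<Longrightarrow> p (c *\<^sub>R x) \<le> c * p x" and zero: "p 0 = 0"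
  shows "sublinear p"
proof -
  have "p (c *\<^sub>R x) = c * p x" if "0 \<le> c" for c x
  proof (cases "c = 0")
    case False
    with that have c: "0 < c" by simp
    have "p ((1/c) *\<^sub>R (c *\<^sub>R x)) \<le> (1/c) * p (c *\<^sub>R x)" using c by (intro scale) auto
    then have "c * p x \<le> p (c *\<^sub>R x)" using c by (simp add: field_simps)
    then show ?thesis using scale[OF c, of x] by linarith
  qed (simp add: zero)
  then show ?thesis using add by (simp add: sublinear_def)
qed

lemma sublinear_zero: "sublinear p \<Longrightarrow> p 0 = 0"
  unfolding sublinear_def by (metis mult_zero_left order_refl scaleR_zero_left)

lemma sublinear_neg:
  assumes "sublinear p"
  shows "- p (- x) \<le> p x"
proof -
  have "p (x + - x) \<le> p x + p (- x)" using assms unfolding sublinear_def by blast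
  then show ?thesis using sublinear_zero[OF assms] by simp
qed

text \<open>Any two members of a chain lie above a common member \<open>s\<close>, so the
  subadditivity of \<open>s\<close> yields \<open>q x + q' y\<close> as an upper bound for the
  infimum at \<open>x + y\<close>. The lower bound \<open>- p (- x)\<close> keeps the infima
  finite.\<close>

lemma sublinear_Inf_chain:
  fixes \<C> :: "('a::real_vector \<Rightarrow> real) set"
  assumes ne: "\<C> \<noteq> {}" and sub: "\<And>q. q \<in> \<C> \<Longrightarrow> sublinear q"
    and lb: "\<And>q x. q \<in> \<C> \<Longrightarrow> - p (- x) \<le> q x"
    and chain: "\<And>q q'. q \<in> \<C> \<Longrightarrow> q' \<in> \<C> \<Longrightarrow> q \<le> q' \<or> q' \<le> q"
  shows "sublinear (\<lambda>x. INF q\<in>\<C>. q x)"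
proof -
  have bdd: "bdd_below ((\<lambda>q. q x) ` \<C>)" for x
    using lb by (auto intro!: bdd_belowI)
  show ?thesis
  proof (rule sublinearI)
    fix x y
    have add_le: "(INF q\<in>\<C>. q (x + y)) \<le> q x + q' y" if qq: "q \<in> \<C>" "q' \<in> \<C>" for q q'
    proof -
      obtain s where s: "s \<in> \<C>" "s \<le> q" "s \<le> q'" using chain[OF qq] qq by (metis order_refl)
      have "(INF q\<in>\<C>. q (x + y)) \<le> s (x + y)" by (rule cINF_lower[OF bdd s(1)])
      also have "\<dots> \<le> s x + s y" using sub[OF s(1)] by (simp add: sublinear_def)
      also have "\<dots> \<le> q x + q' y" using s by (auto simp: le_fun_def intro: add_mono)
      finally show ?thesis .
    qed
    have "(INF q\<in>\<C>. q (x + y)) - q x \<le> q' y" if "q \<in> \<C>" "q' \<in> \<C>" for q q'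
      using add_le[OF that] by linarith
    then have "(INF q\<in>\<C>. q (x + y)) - q x \<le> (INF q\<in>\<C>. q y)" if "q \<in> \<C>" for q
      using that ne by (intro cINF_greatest) auto
    then have "(INF q\<in>\<C>. q (x + y)) - (INF q\<in>\<C>. q y) \<le> q x" if "q \<in> \<C>" for q
      using that by (simp add: diff_le_eq add.commute)
    then have "(INF q\<in>\<C>. q (x + y)) - (INF q\<in>\<C>. q y) \<le> (INF q\<in>\<C>. q x)"
      using ne by (intro cINF_greatest) auto
    then show "(INF q\<in>\<C>. q (x + y)) \<le> (INF q\<in>\<C>. q x) + (INF q\<in>\<C>. q y)" by simp
  next
    fix c :: real and x :: 'a assume c: "0 < c"
    have "(INF q\<in>\<C>. q (c *\<^sub>R x)) / c \<le> (INF q\<in>\<C>. q x)"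
    proof (rule cINF_greatest[OF ne])
      fix q assume q: "q \<in> \<C>"
      have "(INF q\<in>\<C>. q (c *\<^sub>R x)) \<le> q (c *\<^sub>R x)" by (rule cINF_lower[OF bdd q])
      also have "\<dots> = c * q x" using sub[OF q] c by (simp add: sublinear_def)
      finally show "(INF q\<in>\<C>. q (c *\<^sub>R x)) / c \<le> q x" using c by (simp add: field_simps)
    qed
    then show "(INF q\<in>\<C>. q (c *\<^sub>R x)) \<le> c * (INF q\<in>\<C>. q x)" using c by (simp add: field_simps)
  next
    have "(\<lambda>q. q 0) ` \<C> = {0}" using ne sub sublinear_zero by force
    then show "(INF q\<in>\<C>. q 0) = 0" by simp
  qed
qed

text \<open>Zorn's lemma for the reversed pointwise order. A sublinear \<open>q\<close> below
  \<open>p\<close> satisfies \<open>- p (- x) \<le> - q (- x) \<le> q x\<close>, so pointwise infima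
  of chains exist and are again sublinear.\<close>

lemma minimal_sublinear:
  fixes p :: "'a::real_vector \<Rightarrow> real"
  assumes "sublinear p"
  obtains q where "sublinear q" "q \<le> p" "\<And>q'. sublinear q' \<Longrightarrow> q' \<le> q \<Longrightarrow> q' = q"
proof -
  let ?A = "{q. sublinear q \<and> q \<le> p}"
  have "\<exists>m\<in>?A. \<forall>a\<in>?A. m \<ge> a \<longrightarrow> a = m"
  proof (rule predicate_Zorn)
    show "partial_order_on ?A (relation_of (\<ge>) ?A)"
      by (rule partial_order_on_relation_ofI) auto
  next
    fix \<C> assume \<C>: "\<C> \<in> Chains (relation_of (\<ge>) ?A)"
    then have sub: "\<C> \<subseteq> ?A" by (rule Chains_relation_of)
    have ch: "q \<le> q' \<or> q' \<le> q" if "q \<in> \<C>" "q' \<in> \<C>" for q q'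
      using \<C> that unfolding Chains_def relation_of_def by auto
    show "\<exists>u\<in>?A. \<forall>a\<in>\<C>. u \<le> a"
    proof (cases "\<C> = {}")
      case True then show ?thesis using assms by auto
    next
      case False
      have lb: "- p (- x) \<le> q x" if "q \<in> \<C>" for q x
      proof -
        have "sublinear q" "q (- x) \<le> p (- x)" using sub that by (auto simp: le_fun_def)
        then show ?thesis using sublinear_neg[of q x] by linarith
      qed
      let ?q = "\<lambda>x. INF q\<in>\<C>. q x"
      have 1: "sublinear ?q"
        by (rule sublinear_Inf_chain[where p = p]) (use False sub lb ch in auto)
      have 2: "\<forall>a\<in>\<C>. ?q \<le> a"
        unfolding le_fun_def by (auto intro!: cINF_lower bdd_belowI dest: lb)
      obtain a where "a \<in> \<C>" using False by blast
      then have "?q \<le> p" using 2 sub by (metis (mono_tags, lifting) mem_Collect_eq order_trans subsetD)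
      then show ?thesis using 1 2 by blast
    qed
  qed
  then show ?thesis using that by auto
qed

lemma minimal_sublinear_additive:
  fixes q :: "'a::real_vector \<Rightarrow> real"
  assumes q: "sublinear q" and min: "\<And>q'. sublinear q' \<Longrightarrow> q' \<le> q \<Longrightarrow> q' = q"
  shows "q (x + y) = q x + q y"
proof -
  \<comment> \<open>The sublinear functional \<open>g \<le> q\<close> satisfies \<open>g x \<le> q (x + y) - q y\<close>, so minimality makes \<open>q\<close> superadditive.\<close>
  define g where "g z = (INF t\<in>{0..}. q (z + t *\<^sub>R y) - t * q y)" for z
  have sub: "q (u + v) \<le> q u + q v" for u v using q by (simp add: sublinear_def)
  have hom: "q (c *\<^sub>R u) = c * q u" if "0 \<le> c" for c u using q that by (simp add: sublinear_def)
  have lb: "- q (- z) \<le> q (z + t *\<^sub>R y) - t * q y" if "0 \<le> t" for z t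
    using sub[of "z + t *\<^sub>R y" "- z"] hom[OF that, of y] by (simp add: algebra_simps)
  have bdd: "bdd_below ((\<lambda>t. q (z + t *\<^sub>R y) - t * q y) ` {0..})" for z
    using lb by (intro bdd_belowI2) auto
  have up: "g z \<le> q (z + t *\<^sub>R y) - t * q y" if "0 \<le> t" for z t
    unfolding g_def using that by (intro cINF_lower[OF bdd]) auto
  have "sublinear g"
  proof (rule sublinearI)
    fix u v
    have "g (u + v) \<le> (q (u + s *\<^sub>R y) - s * q y) + (q (v + t *\<^sub>R y) - t * q y)" if "0 \<le> s" "0 \<le> t" for s t
      using up[of "s + t" "u + v"] sub[of "u + s *\<^sub>R y" "v + t *\<^sub>R y"] that
      by (simp add: algebra_simps)
    then have "g (u + v) - (q (u + s *\<^sub>R y) - s * q y) \<le> q (v + t *\<^sub>R y) - t * q y" if "0 \<le> s" "0 \<le> t" for s t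
      using that by (simp add: diff_le_eq add.commute)
    then have "g (u + v) - (q (u + s *\<^sub>R y) - s * q y) \<le> g v" if "0 \<le> s" for s
      unfolding g_def[of v] using that by (intro cINF_greatest) auto
    then have "g (u + v) - g v \<le> q (u + s *\<^sub>R y) - s * q y" if "0 \<le> s" for s
      using that by (simp add: diff_le_eq add.commute)
    then have "g (u + v) - g v \<le> g u"
      unfolding g_def[of u] by (intro cINF_greatest) auto
    then show "g (u + v) \<le> g u + g v" by simp
  next
    fix c :: real and u :: 'a assume c: "0 < c"
    have "g (c *\<^sub>R u) / c \<le> g u"
      unfolding g_def[of u]
    proof (rule cINF_greatest)
      fix t :: real assume "t \<in> {0..}"
      then have "g (c *\<^sub>R u) \<le> q (c *\<^sub>R (u + t *\<^sub>R y)) - (c * t) * q y"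
        using up[of "c * t" "c *\<^sub>R u"] c by (simp add: algebra_simps)
      then have "g (c *\<^sub>R u) \<le> c * (q (u + t *\<^sub>R y) - t * q y)"
        using hom[of c "u + t *\<^sub>R y"] c by (simp add: algebra_simps)
      then show "g (c *\<^sub>R u) / c \<le> q (u + t *\<^sub>R y) - t * q y" using c by (simp add: field_simps)
    qed auto
    then show "g (c *\<^sub>R u) \<le> c * g u" using c by (simp add: field_simps)
  next
    have "(\<lambda>t. q (0 + t *\<^sub>R y) - t * q y) ` {0..} = {0}"
      using hom by force
    then show "g 0 = 0" unfolding g_def by simp
  qed
  moreover have "g \<le> q" using up[of 0] by (simp add: le_fun_def)
  ultimately have "g = q" by (rule min)
  then have "q x \<le> q (x + y) - q y" using up[of 1 x] by simp
  then show ?thesis using sub[of x y] by simp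
qed

text \<open>The Hahn-Banach theorem without extension from subspaces: a minimal sublinear functional
  is additive, hence odd, and oddness extends homogeneity to negative scalars.\<close>

lemma linear_below_sublinear:
  fixes p :: "'a::real_vector \<Rightarrow> real"
  assumes "sublinear p"
  obtains f where "linear f" "\<And>x. f x \<le> p x"
proof -
  obtain q where q: "sublinear q" "q \<le> p" and min: "\<And>q'. sublinear q' \<Longrightarrow> q' \<le> q \<Longrightarrow> q' = q"
    using minimal_sublinear[OF assms] by blast
  have add: "q (x + y) = q x + q y" for x y
    by (rule minimal_sublinear_additive[OF q(1) min])
  have neg: "q (- x) = - q x" for x
    using add[of x "- x"] sublinear_zero[OF q(1)] by simp
  have "q (c *\<^sub>R x) = c * q x" for c x
  proof (cases "0 \<le> c")
    case True then show ?thesis using q(1) by (simp add: sublinear_def)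
  next
    case False
    then have "0 \<le> - c" by simp
    then have "q ((- c) *\<^sub>R x) = (- c) * q x" using q(1) unfolding sublinear_def by blast
    then show ?thesis using neg[of "c *\<^sub>R x"] by simp
  qed
  then have "linear q" by (intro linearI) (simp_all add: add)
  then show ?thesis using that q(2) by (auto simp: le_fun_def)
qed

lemma separating_functional:
  fixes D :: "'a::real_normed_vector set"
  assumes "convex D" and r: "\<And>d. d \<in> D \<Longrightarrow> r \<le> norm d"
  obtains f where "bounded_linear f" "\<And>x. \<bar>f x\<bar> \<le> norm x" "\<And>d. d \<in> D \<Longrightarrow> r \<le> f d"
proof (cases "D = {}")
  case True
  then show ?thesis using that[of "\<lambda>_. 0"] by (simp add: bounded_linear_zero)
next
  case False
  define I where "I = {0::real..} \<times> D"
  define h where "h v i = norm (v + fst i *\<^sub>R snd i) - fst i * r" for v :: 'a and i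
  \<comment> \<open>\<open>p v\<close> is the infimum of \<open>norm (v + t d) - t r\<close>; taking \<open>t = 1\<close> shows \<open>p (- d) \<le> - r\<close>.\<close>
  define p where "p v = (INF i\<in>I. h v i)" for v
  have I: "I \<noteq> {}" using False by (auto simp: I_def)
  have lb: "- norm v \<le> h v i" if iI: "i \<in> I" for v i
  proof -
    obtain t d where i: "i = (t, d)" "0 \<le> t" "d \<in> D" using iI by (auto simp: I_def)
    have "t * r \<le> norm (t *\<^sub>R d)" using i r[of d] by (simp add: mult_left_mono)
    also have "\<dots> \<le> norm (v + t *\<^sub>R d) + norm v"
      by (metis add.commute norm_triangle_sub add_diff_cancel_left' norm_triangle_ineq4)
    finally show ?thesis by (simp add: h_def i)
  qed
  have bdd: "bdd_below (h v ` I)" for v using lb by (intro bdd_belowI2) auto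
  have up: "p v \<le> h v i" if "i \<in> I" for v i
    unfolding p_def by (rule cINF_lower[OF bdd that])
  have pn: "p v \<le> norm v" for v
  proof -
    obtain d where "d \<in> D" using False by blast
    then show ?thesis using up[of "(0, d)" v] by (simp add: I_def h_def)
  qed
  have "sublinear p"
  proof (rule sublinearI)
    fix u v
    have "p (u + v) \<le> h u i + h v j" if ij: "i \<in> I" "j \<in> I" for i j
    proof -
      obtain s c t d where i: "i = (s, c)" "0 \<le> s" "c \<in> D" and j: "j = (t, d)" "0 \<le> t" "d \<in> D"
        using ij by (auto simp: I_def)
      \<comment> \<open>Convexity of \<open>D\<close> merges the two points into one with weight
        \<open>s + t\<close>. If both weights vanish, any point of \<open>D\<close> serves.\<close>
      obtain e where e: "e \<in> D" "(s + t) *\<^sub>R e = s *\<^sub>R c + t *\<^sub>R d"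
      proof (cases "s + t = 0")
        case True
        then have "s = 0" "t = 0" using i j by auto
        then show ?thesis using that[of c] i by simp
      next
        case False
        then have st: "0 < s + t" using i j by auto
        let ?e = "(s/(s+t)) *\<^sub>R c + (t/(s+t)) *\<^sub>R d"
        have "?e \<in> D" using assms(1) i j st
          by (intro convexD) (auto simp: add_divide_distrib[symmetric])
        moreover have "(s + t) *\<^sub>R ?e = s *\<^sub>R c + t *\<^sub>R d"
          using st by (simp add: scaleR_add_right)
        ultimately show ?thesis using that by blast
      qed
      have "p (u + v) \<le> h (u + v) (s + t, e)" using i j e by (intro up) (auto simp: I_def)
      also have "\<dots> = norm ((u + s *\<^sub>R c) + (v + t *\<^sub>R d)) - s * r - t * r"
        using e by (simp add: h_def algebra_simps)
      also have "\<dots> \<le> h u i + h v j"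
        using norm_triangle_ineq[of "u + s *\<^sub>R c" "v + t *\<^sub>R d"] by (simp add: h_def i j)
      finally show ?thesis .
    qed
    then have "p (u + v) - h u i \<le> p v" if "i \<in> I" for i
      unfolding p_def[of v] using that I by (intro cINF_greatest) (auto simp: algebra_simps)
    then have "p (u + v) - p v \<le> p u"
      unfolding p_def[of u] using I by (intro cINF_greatest) (auto simp: algebra_simps)
    then show "p (u + v) \<le> p u + p v" by simp
  next
    fix c :: real and v assume c: "0 < c"
    have "p (c *\<^sub>R v) / c \<le> p v"
      unfolding p_def[of v]
    proof (rule cINF_greatest[OF I])
      fix i assume "i \<in> I"
      then obtain t d where i: "i = (t, d)" "0 \<le> t" "d \<in> D" by (auto simp: I_def)
      have "p (c *\<^sub>R v) \<le> h (c *\<^sub>R v) (c * t, d)" using c i by (intro up) (auto simp: I_def)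
      also have "\<dots> = norm (c *\<^sub>R (v + t *\<^sub>R d)) - c * t * r" by (simp add: h_def algebra_simps)
      also have "\<dots> = c * h v i" using c by (simp add: h_def i right_diff_distrib)
      finally show "p (c *\<^sub>R v) / c \<le> h v i" using c by (simp add: field_simps)
    qed
    then show "p (c *\<^sub>R v) \<le> c * p v" using c by (simp add: field_simps)
  next
    have "0 \<le> p 0" unfolding p_def using lb[of _ 0] I by (intro cINF_greatest) auto
    then show "p 0 = 0" using pn[of 0] by simp
  qed
  then obtain f where f: "linear f" "\<And>x. f x \<le> p x" using linear_below_sublinear by metis
  have neg: "f (- x) = - f x" for x using f(1) by (rule linear_neg)
  have fn: "\<bar>f x\<bar> \<le> norm x" for x
    using f(2)[of x] f(2)[of "- x"] pn[of x] pn[of "- x"] neg[of x] by simp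
  have "bounded_linear f"
    using f(1) fn by (intro linear_conv_bounded_linear[THEN iffD1] bounded_linear_intro[where K=1])
       (auto simp: linear_add linear_scale)
  moreover have "r \<le> f d" if "d \<in> D" for d
    using f(2)[of "- d"] up[of "(1, d)" "- d"] that neg[of d] by (simp add: I_def h_def)
  ultimately show ?thesis using that fn by blast
qed

section \<open>Weakly compact sets\<close>

lemma openin_weak_vimage:
  fixes f :: "'a::real_normed_vector \<Rightarrow> real"
  assumes "bounded_linear f" "open U"
  shows "openin weak_topology (f -` U)"
  unfolding weak_topology_def using assms by (intro topology_generated_by_Basis) auto

lemma topspace_weak [simp]: "topspace weak_topology = UNIV"
  using openin_subset[OF openin_weak_vimage[OF bounded_linear_zero open_UNIV]] by auto

text \<open>A ball of radius \<open>r\<close> around \<open>x\<close> misses \<open>S\<close>, so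
  the convex set of differences \<open>x - s\<close> stays at distance at least \<open>r\<close>
  from 0 and \<open>separating_functional\<close> applies to it.\<close>

lemma separating_functional_point:
  fixes S :: "'a::real_normed_vector set"
  assumes "closed S" "convex S" "x \<notin> S"
  obtains f :: "'a \<Rightarrow> real" and r where "bounded_linear f" "0 < r" "\<And>s. s \<in> S \<Longrightarrow> f s \<le> f x - r"
proof -
  obtain r where r: "0 < r" "ball x r \<subseteq> - S"
    using assms open_contains_ball[of "- S"] by (auto simp: open_Compl)
  let ?D = "(\<lambda>s. x - s) ` S"
  have "convex ?D"
    using convex_translation[OF convex_negations[OF assms(2)], of x] by (simp add: image_image)
  moreover have "r \<le> norm d" if "d \<in> ?D" for d
    using that r(2) by (force simp: dist_norm)
  ultimately obtain f where f: "bounded_linear f" "\<And>d. d \<in> ?D \<Longrightarrow> r \<le> f d"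
    using separating_functional by metis
  interpret bounded_linear f by (rule f(1))
  have "f s \<le> f x - r" if "s \<in> S" for s
    using f(2)[of "x - s"] that by (simp add: diff)
  then show ?thesis using that f(1) r(1) by blast
qed

lemma norming_functional:
  fixes x :: "'a::real_normed_vector"
  obtains f where "bounded_linear f" "\<And>v. \<bar>f v\<bar> \<le> norm v" "f x = norm x"
proof -
  obtain f where f: "bounded_linear f" "\<And>v. \<bar>f v\<bar> \<le> norm v" "norm x \<le> f x"
    using separating_functional[of "{x}" "norm x"] by auto
  have "f x = norm x" using f(2)[of x] f(3) by linarith
  then show ?thesis using f(1,2) by (intro that)
qed

text \<open>Mazur's theorem: for each point outside \<open>S\<close>, an open half-space given by a
  separating functional is a weak neighbourhood of the point that misses \<open>S\<close>.\<close>

lemma closedin_weak_convex: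
  fixes S :: "'a::real_normed_vector set"
  assumes "closed S" "convex S"
  shows "closedin weak_topology S"
proof -
  have "\<exists>T. openin weak_topology T \<and> x \<in> T \<and> T \<subseteq> - S" if x: "x \<in> - S" for x
  proof -
    obtain f :: "'a \<Rightarrow> real" and r where f: "bounded_linear f" "0 < r" "\<And>s. s \<in> S \<Longrightarrow> f s \<le> f x - r"
      using separating_functional_point[OF assms, of x] x by auto
    have "openin weak_topology (f -` {f x - r <..})"
      by (rule openin_weak_vimage[OF f(1)]) simp
    then show ?thesis using f by (intro exI[of _ "f -` {f x - r <..}"]) force
  qed
  then have "openin weak_topology (- S)" by (subst openin_subopen) auto
  then show ?thesis by (simp add: closedin_def Compl_eq_Diff_UNIV)
qed

lemma weakly_compact_Inter:
  fixes C :: "'a::real_normed_vector set"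
  assumes "weakly_compact C" and "\<And>S. S \<in> \<F> \<Longrightarrow> closed S \<and> convex S"
    and "\<And>\<G>. finite \<G> \<Longrightarrow> \<G> \<subseteq> \<F> \<Longrightarrow> C \<inter> \<Inter>\<G> \<noteq> {}"
  shows "C \<inter> \<Inter>\<F> \<noteq> {}"
proof -
  have "\<forall>\<U>. (\<forall>S\<in>\<U>. closedin weak_topology S) \<and> (\<forall>\<G>. finite \<G> \<and> \<G> \<subseteq> \<U> \<longrightarrow> C \<inter> \<Inter>\<G> \<noteq> {})
      \<longrightarrow> C \<inter> \<Inter>\<U> \<noteq> {}"
    by (rule conjunct2[OF assms(1)[unfolded weakly_compact_def compactin_fip]])
  moreover have "\<forall>S\<in>\<F>. closedin weak_topology S"
    using assms(2) by (simp add: closedin_weak_convex)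
  ultimately show ?thesis using assms(3) by simp
qed

text \<open>Finitely many closed convex sets that each contain almost all terms have a common term,
  so weak compactness gives a point in all such sets. This is the only property of weak cluster
  points used later.\<close>

lemma weak_cluster_point:
  fixes C :: "'a::real_normed_vector set"
  assumes "weakly_compact C" "\<And>n. x n \<in> C"
  obtains y where "y \<in> C"
    "\<And>S. closed S \<Longrightarrow> convex S \<Longrightarrow> eventually (\<lambda>n::nat. x n \<in> S) sequentially \<Longrightarrow> y \<in> S"
proof -
  let ?F = "{S. closed S \<and> convex S \<and> eventually (\<lambda>n. x n \<in> S) sequentially}"
  have "C \<inter> \<Inter>?F \<noteq> {}"
  proof (rule weakly_compact_Inter[OF assms(1)])
    fix \<G> assume "finite \<G>" "\<G> \<subseteq> ?F"
    then have "eventually (\<lambda>n. \<forall>S\<in>\<G>. x n \<in> S) sequentially"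
      by (subst eventually_ball_finite_distrib) auto
    then obtain n where "\<forall>S\<in>\<G>. x n \<in> S" by (auto simp: eventually_sequentially)
    then show "C \<inter> \<Inter>\<G> \<noteq> {}" using assms(2) by blast
  qed auto
  then have "\<exists>y. y \<in> C \<inter> \<Inter>?F" by (simp only: ex_in_conv not_False_eq_True)
  then obtain y where "y \<in> C \<inter> \<Inter>?F" ..
  then show ?thesis by (intro that[of y]) auto
qed

text \<open>Every closed ball around the norm limit is a closed convex set containing a tail, so the
  cluster point in \<open>C\<close> must be that limit.\<close>

lemma weakly_compact_imp_closed:
  fixes C :: "'a::real_normed_vector set"
  assumes "weakly_compact C"
  shows "closed C"
  unfolding closed_sequential_limits
proof (intro allI impI, elim conjE)
  fix x l assume x: "\<forall>n. x n \<in> C" and l: "x \<longlonglongrightarrow> l"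
  obtain y where y: "y \<in> C"
    "\<And>S. closed S \<Longrightarrow> convex S \<Longrightarrow> eventually (\<lambda>n. x n \<in> S) sequentially \<Longrightarrow> y \<in> S"
    using weak_cluster_point[OF assms, of x] x by blast
  have "dist l y \<le> 0"
  proof (rule field_le_epsilon)
    fix e :: real assume "0 < e"
    then have "eventually (\<lambda>n. x n \<in> cball l e) sequentially"
      using tendstoD[OF l, of e] by (auto elim!: eventually_mono simp: dist_commute)
    then show "dist l y \<le> 0 + e" using y(2)[of "cball l e"] by simp
  qed
  then show "l \<in> C" using y(1) by simp
qed

lemma weakly_compact_imp_bounded:
  fixes C :: "'a::real_normed_vector set"
  assumes "weakly_compact C"
  shows "bounded C"
proof -
  \<comment> \<open>Uniform boundedness: apply Baire to the sets of functionals bounded by \<open>m\<close> on \<open>C\<close>.\<close>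
  define A where "A m = {f :: 'a \<Rightarrow>\<^sub>L real. \<forall>x\<in>C. \<bar>blinfun_apply f x\<bar> \<le> real m}" for m :: nat
  have "\<exists>m. f \<in> A m" for f
  proof (rule ccontr)
    assume "\<nexists>m. f \<in> A m"
    then have "\<forall>m. \<exists>x\<in>C. real m < \<bar>blinfun_apply f x\<bar>" by (auto simp: A_def not_le)
    then obtain x where x: "\<And>m. x m \<in> C" "\<And>m. real m < \<bar>blinfun_apply f (x m)\<bar>" by metis
    have bl: "bounded_linear (blinfun_apply f)" by (rule blinfun.bounded_linear_right)
    \<comment> \<open>The slabs \<open>?U m\<close> are weakly open and increase with
      \<open>m\<close>. A finite subcover with indices at most \<open>N\<close> misses
      \<open>x N\<close>.\<close>
    let ?U = "\<lambda>m. blinfun_apply f -` {- real m <..< real m}"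
    have "compactin weak_topology C" using assms by (simp add: weakly_compact_def)
    moreover have "\<And>U. U \<in> range ?U \<Longrightarrow> openin weak_topology U"
      using openin_weak_vimage[OF bl] by auto
    moreover have "C \<subseteq> \<Union>(range ?U)"
    proof
      fix y assume "y \<in> C"
      obtain m :: nat where "\<bar>blinfun_apply f y\<bar> < real m" using reals_Archimedean2 by blast
      then show "y \<in> \<Union>(range ?U)" by (auto intro!: exI[of _ m])
    qed
    ultimately obtain \<G> where \<G>: "finite \<G>" "\<G> \<subseteq> range ?U" "C \<subseteq> \<Union>\<G>"
      unfolding compactin_def by meson
    then obtain M where M: "finite M" "\<G> = ?U ` M" by (meson finite_subset_image)
    have "\<exists>N. \<forall>m\<in>M. m \<le> N" using M(1) by (simp add: finite_nat_set_iff_bounded_le)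
    then obtain N where N: "\<And>m. m \<in> M \<Longrightarrow> m \<le> N" by blast
    have "x N \<in> \<Union>(?U ` M)" using x(1)[of N] \<G>(3) M(2) by blast
    then obtain m where "m \<in> M" "\<bar>blinfun_apply f (x N)\<bar> < real m" by (auto simp: abs_less_iff)
    then show False using x(2)[of N] N[of m] by linarith
  qed
  then have un: "\<Union>(range A) = UNIV" by blast
  have cl: "closed (A m)" for m
  proof -
    have "A m = (\<Inter>x\<in>C. {f. \<bar>blinfun_apply f x\<bar> \<le> real m})" by (auto simp: A_def)
    then show ?thesis by (auto intro!: closed_INT closed_Collect_le continuous_intros)
  qed
  have "\<exists>m. interior (A m) \<noteq> {}"
  proof (rule ccontr)
    assume "\<nexists>m. interior (A m) \<noteq> {}"
    then have "euclidean interior_of \<Union>(range A) = {}"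
      using cl completely_metrizable_space_euclidean
      by (intro Baire_category_alt) auto
    then show False using un by simp
  qed
  then obtain m f0 where "f0 \<in> interior (A m)" by blast
  then obtain r where r: "0 < r" "cball f0 r \<subseteq> A m"
    by (meson mem_interior_cball)
  have "norm x \<le> 2 * real m / r" if x: "x \<in> C" for x
  proof -
    \<comment> \<open>With \<open>f\<close> norming \<open>x\<close>, both \<open>f0\<close> and
      \<open>f0 + r g\<close> lie in \<open>A m\<close>; subtracting their values at
      \<open>x\<close> bounds \<open>r * norm x\<close> by \<open>2 m\<close>.\<close>
    obtain f where f: "bounded_linear f" "\<And>v. \<bar>f v\<bar> \<le> norm v" "f x = norm x"
      using norming_functional by blast
    define g where "g = Blinfun f"
    have g: "blinfun_apply g = f" unfolding g_def by (rule bounded_linear_Blinfun_apply[OF f(1)])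
    have "norm g \<le> 1" using f(2) by (intro norm_blinfun_bound) (auto simp: g)
    then have "f0 + r *\<^sub>R g \<in> cball f0 r" using r(1) by (simp add: dist_norm)
    then have "\<bar>blinfun_apply (f0 + r *\<^sub>R g) x\<bar> \<le> real m" using r(2) x by (auto simp: A_def)
    moreover have "\<bar>blinfun_apply f0 x\<bar> \<le> real m"
      using r x by (auto simp: A_def subset_iff)
    ultimately have "\<bar>r * norm x\<bar> \<le> 2 * real m"
      by (simp add: blinfun.add_left blinfun.scaleR_left g f(3))
    then show ?thesis using r(1) by (simp add: field_simps abs_mult)
  qed
  then show ?thesis by (auto simp: bounded_iff)
qed

section \<open>Weak sequential limits and weakly convergent subsequences\<close>

definition weak_limit :: "(nat \<Rightarrow> 'a::real_normed_vector) \<Rightarrow> 'a \<Rightarrow> bool" where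
  "weak_limit x y \<longleftrightarrow> (\<forall>f. bounded_linear f \<longrightarrow> (\<lambda>n. f (x n)) \<longlonglongrightarrow> (f y :: real))"

lemma weak_limit_subseq: "weak_limit x y \<Longrightarrow> strict_mono r \<Longrightarrow> weak_limit (\<lambda>n. x (r n)) y"
  unfolding weak_limit_def using LIMSEQ_subseq_LIMSEQ[unfolded o_def] by blast

text \<open>A functional separating \<open>y\<close> from \<open>S\<close> would stay below
  \<open>f y - r\<close> at infinitely many terms, although its values converge to
  \<open>f y\<close>. Having \<open>frequently\<close> in the hypothesis lets the lemma apply to the
  terms indexed by an arbitrary infinite set.\<close>

lemma weak_limit_in_closed_convex:
  fixes S :: "'a::real_normed_vector set"
  assumes "weak_limit x y" "closed S" "convex S" "frequently (\<lambda>n. x n \<in> S) sequentially"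
  shows "y \<in> S"
proof (rule ccontr)
  assume "y \<notin> S"
  then obtain f :: "'a \<Rightarrow> real" and r
    where f: "bounded_linear f" "0 < r" "\<And>s. s \<in> S \<Longrightarrow> f s \<le> f y - r"
    using separating_functional_point[OF assms(2,3)] by blast
  have "(\<lambda>n. f (x n)) \<longlonglongrightarrow> f y" using assms(1) f(1) by (simp add: weak_limit_def)
  then have "eventually (\<lambda>n. f y - r < f (x n)) sequentially"
    using f(2) by (intro order_tendstoD) auto
  then have "frequently (\<lambda>n. x n \<in> S \<and> f y - r < f (x n)) sequentially"
    using assms(4) by (simp add: frequently_eventually_frequently)
  then obtain n where "x n \<in> S" "f y - r < f (x n)" by (auto dest: frequently_ex)
  then show False using f(3)[of "x n"] by simp
qed

lemma weak_limit_diff: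
  assumes "weak_limit x a" "weak_limit y b"
  shows "weak_limit (\<lambda>n. x n - y n) (a - b)"
  unfolding weak_limit_def
proof (intro allI impI)
  fix f :: "'a \<Rightarrow> real" assume f: "bounded_linear f"
  then interpret bounded_linear f .
  show "(\<lambda>n. f (x n - y n)) \<longlonglongrightarrow> f (a - b)"
    using assms f unfolding weak_limit_def diff by (auto intro: tendsto_diff)
qed

lemma countable_dense_span:
  fixes x :: "nat \<Rightarrow> 'a::real_normed_vector"
  obtains g :: "nat \<Rightarrow> 'a" where "closure (range g) = closure (span (range x))"
proof -
  \<comment> \<open>Finite rational combinations are coded by lists of coefficient-index pairs.
    These form a countable type, so \<open>from_nat\<close> enumerates them.\<close>
  define h :: "(rat \<times> nat) list \<Rightarrow> 'a" where
    "h l = sum_list (map (\<lambda>(q, i). of_rat q *\<^sub>R x i) l)" for l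
  have hx: "of_rat q *\<^sub>R x i \<in> range h" for q i
    by (rule range_eqI[of _ _ "[(q, i)]"]) (simp add: h_def)
  have hadd: "u + v \<in> range h" if "u \<in> range h" "v \<in> range h" for u v
  proof -
    from that obtain l m where "u = h l" "v = h m" by blast
    then show ?thesis by (intro range_eqI[of _ _ "l @ m"]) (simp add: h_def)
  qed
  have cadd: "u + v \<in> closure (range h)" if uv: "u \<in> closure (range h)" "v \<in> closure (range h)" for u v
  proof -
    obtain a b where ab: "\<And>n::nat. a n \<in> range h" "a \<longlonglongrightarrow> u" "\<And>n::nat. b n \<in> range h" "b \<longlonglongrightarrow> v"
      using uv unfolding closure_sequential by metis
    then show ?thesis unfolding closure_sequential
      by (intro exI[of _ "\<lambda>n. a n + b n"]) (auto intro!: hadd tendsto_add)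
  qed
  have cx: "c *\<^sub>R x i \<in> closure (range h)" for c i
  proof -
    have "c \<in> closure \<rat>" by (simp add: Rats_closure_real)
    then obtain q where q: "\<And>n::nat. q n \<in> \<rat>" "q \<longlonglongrightarrow> c"
      unfolding closure_sequential by metis
    have "q n *\<^sub>R x i \<in> range h" for n
      using q(1)[of n] hx by (auto elim!: Rats_cases)
    then show ?thesis unfolding closure_sequential
      by (intro exI[of _ "\<lambda>n. q n *\<^sub>R x i"]) (auto intro!: tendsto_scaleR q(2))
  qed
  have z: "0 \<in> closure (range h)" using cx[of 0 0] by simp
  have "v \<in> closure (range h)" if "v \<in> span (range x)" for v
    using that
  proof (induction rule: span_induct_alt)
    case base then show ?case by (rule z)
  next
    case (step c u y)
    then show ?case using cadd cx by blast
  qed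
  then have "closure (span (range x)) \<subseteq> closure (range h)"
    by (intro closure_minimal) auto
  moreover have "h l \<in> span (range x)" for l
    unfolding h_def by (induction l) (auto intro!: span_add[OF span_scale[OF span_base]] span_zero)
  then have "closure (range h) \<subseteq> closure (span (range x))" by (intro closure_mono) auto
  ultimately have "closure (range h) = closure (span (range x))" by blast
  moreover have "range (h \<circ> from_nat) = range h"
    by (simp only: image_comp[symmetric] surj_from_nat)
  ultimately show ?thesis using that[of "h \<circ> from_nat"] by simp
qed

text \<open>The sequential half of the Eberlein-Smulian theorem. Functionals norming a countable
  dense subset of the closed span separate the points of that span. A diagonal subsequence makes all
  of them converge, so the cluster points of all further subsequences coincide.\<close>

theorem weakly_compact_imp_weak_subseq:
  fixes C :: "'a::real_normed_vector set"
  assumes C: "weakly_compact C" and x: "\<And>n :: nat. x n \<in> C"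
  obtains y s where "y \<in> C" "strict_mono s" "weak_limit (\<lambda>n. x (s n)) y"
proof -
  obtain g :: "nat \<Rightarrow> 'a" where g: "closure (range g) = closure (span (range x))"
    by (rule countable_dense_span[of x])
  have "\<forall>n. \<exists>f. bounded_linear f \<and> (\<forall>v. \<bar>f v\<bar> \<le> norm v) \<and> f (g n) = norm (g n)"
    using norming_functional by blast
  then obtain F :: "nat \<Rightarrow> 'a \<Rightarrow> real" where F: "\<And>n. bounded_linear (F n)"
    "\<And>n v. \<bar>F n v\<bar> \<le> norm v" "\<And>n. F n (g n) = norm (g n)" using choice[where Q = "\<lambda>n f. bounded_linear f \<and> (\<forall>v. \<bar>f v\<bar> \<le> norm v) \<and> f (g n) = norm (g n)"] by blast
  obtain B where B: "\<And>v. v \<in> C \<Longrightarrow> norm v \<le> B"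
    using weakly_compact_imp_bounded[OF C] by (auto simp: bounded_iff)
  interpret S: subseqs "\<lambda>n s. convergent (\<lambda>i. F n (x (s i)))"
  proof
    fix n and s :: "nat \<Rightarrow> nat"
    have "bounded (range (\<lambda>i. F n (x (s i))))"
      unfolding bounded_iff using F(2) B[OF x] by (auto intro!: exI[of _ B] order_trans[OF F(2)])
    then obtain l r where "strict_mono (r::nat\<Rightarrow>nat)" "((\<lambda>i. F n (x (s i))) \<circ> r) \<longlonglongrightarrow> l"
      using bounded_imp_convergent_subsequence by blast
    then show "\<exists>r'. strict_mono r' \<and> convergent (\<lambda>i. F n (x ((s \<circ> r') i)))"
      by (auto simp: convergent_def o_def)
  qed
  define s where "s = S.diagseq"
  have s: "strict_mono s" unfolding s_def by (rule S.subseq_diagseq)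
  have conv: "convergent (\<lambda>i. F n (x (s i)))" for n
  proof -
    \<comment> \<open>The diagonal sequence is known to refine the \<open>n\<close>-th stage only
      after its first \<open>Suc n\<close> terms; the shift is removed afterwards.\<close>
    have "convergent (\<lambda>i. F n (x ((s \<circ> (+) (Suc n)) i)))"
      unfolding s_def
    proof (rule S.diagseq_holds)
      fix r s :: "nat \<Rightarrow> nat" and n assume "strict_mono r" "convergent (\<lambda>i. F n (x (s i)))"
      then show "convergent (\<lambda>i. F n (x ((s \<circ> r) i)))"
        using convergent_subseq_convergent[of "\<lambda>i. F n (x (s i))" r] by (simp add: o_def)
    qed
    then have "convergent (\<lambda>i. F n (x (s (i + Suc n))))" by (simp add: add.commute)
    then show ?thesis using convergent_ignore_initial_segment[of "\<lambda>i. F n (x (s i))" "Suc n"] by simp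
  qed
  \<comment> \<open>Preimages of small balls under \<open>F n\<close> and the closed span are closed
    convex sets containing a tail of the subsequence, so they contain its cluster point.\<close>
  have cluster: "F n z = lim (\<lambda>i. F n (x (s i))) \<and> z \<in> closure (span (range x))"
    if r: "strict_mono r" and
      z: "\<And>S. closed S \<Longrightarrow> convex S \<Longrightarrow> eventually (\<lambda>i. x (s (r i)) \<in> S) sequentially \<Longrightarrow> z \<in> S"
    for r z n
  proof
    let ?l = "lim (\<lambda>i. F n (x (s i)))"
    have lin: "linear (F n)" using F(1) by (rule bounded_linear.linear)
    have cont: "continuous_on UNIV (F n)" using F(1) linear_continuous_on by blast
    have l: "(\<lambda>i. F n (x (s (r i)))) \<longlonglongrightarrow> ?l"
      using conv[of n] LIMSEQ_subseq_LIMSEQ[OF _ r] by (simp add: convergent_LIMSEQ_iff o_def)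
    have "\<bar>F n z - ?l\<bar> \<le> 0"
    proof (rule field_le_epsilon)
      fix e :: real assume e: "0 < e"
      have "convex (F n -` cball ?l e)"
        using convex_linear_vimage[OF lin convex_cball] .
      moreover have "closed (F n -` cball ?l e)"
        by (rule closed_vimage[OF closed_cball cont])
      moreover have "eventually (\<lambda>i. x (s (r i)) \<in> F n -` cball ?l e) sequentially"
        using tendstoD[OF l e] by (auto elim!: eventually_mono simp: dist_commute)
      ultimately have "z \<in> F n -` cball ?l e" by (intro z)
      then show "\<bar>F n z - ?l\<bar> \<le> 0 + e" by (simp add: dist_real_def abs_minus_commute)
    qed
    then show "F n z = ?l" by simp
    show "z \<in> closure (span (range x))"
    proof (rule z)
      show "convex (closure (span (range x)))"
        by (intro convex_closure subspace_imp_convex subspace_span)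
      show "eventually (\<lambda>i. x (s (r i)) \<in> closure (span (range x))) sequentially"
        by (intro always_eventually allI subsetD[OF closure_subset] span_base rangeI)
    qed simp
  qed
  \<comment> \<open>Approximate \<open>z - z'\<close> by some \<open>g n\<close>. As
    \<open>F n\<close> vanishes on \<open>z - z'\<close> and norms \<open>g n\<close>, the vector
    \<open>g n\<close> is itself small, and so is \<open>z - z'\<close>.\<close>
  have uniq: "z = z'"
    if zz: "\<And>n. F n z = F n z'" "z \<in> closure (span (range x))" "z' \<in> closure (span (range x))" for z z'
  proof -
    obtain a b where ab: "\<And>n::nat. a n \<in> span (range x)" "a \<longlonglongrightarrow> z"
      "\<And>n::nat. b n \<in> span (range x)" "b \<longlonglongrightarrow> z'"
      using zz(2,3) unfolding closure_sequential by metis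
    then have "z - z' \<in> closure (range g)" unfolding g closure_sequential
      by (intro exI[of _ "\<lambda>n. a n - b n"]) (auto intro!: span_diff tendsto_diff)
    then have *: "\<exists>n. dist (g n) (z - z') < e" if "0 < e" for e
      using that by (auto simp: closure_approachable)
    have "norm (z - z') \<le> 0"
    proof (rule field_le_epsilon)
      fix e :: real assume "0 < e"
      then obtain n where n: "dist (g n) (z - z') < e/2" using *[of "e/2"] by auto
      interpret Fn: bounded_linear "F n" by (rule F(1))
      have "norm (g n) = F n (g n - (z - z'))" using F(3)[of n] zz(1)[of n] by (simp add: Fn.diff)
      also have "\<dots> \<le> norm (g n - (z - z'))" using F(2)[of n] by (meson abs_le_D1)
      finally have "norm (g n) \<le> e/2" using n by (simp add: dist_norm)
      moreover have "norm (z - z') \<le> norm (g n) + dist (g n) (z - z')"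
        by (metis dist_norm norm_minus_commute norm_triangle_sub add.commute)
      ultimately show "norm (z - z') \<le> 0 + e" using n by simp
    qed
    then show ?thesis by simp
  qed
  obtain y where y: "y \<in> C"
    "\<And>S. closed S \<Longrightarrow> convex S \<Longrightarrow> eventually (\<lambda>i. x (s i) \<in> S) sequentially \<Longrightarrow> y \<in> S"
    using weak_cluster_point[OF C, of "\<lambda>i. x (s i)"] x by blast
  have y_cl: "F n y = lim (\<lambda>i. F n (x (s i))) \<and> y \<in> closure (span (range x))" for n
    using cluster[of id y n] y(2) by (simp add: strict_mono_def)
  \<comment> \<open>A subsequence violating the bound has a cluster point \<open>z\<close> with
    \<open>f z \<ge> f y + e\<close>, yet \<open>z = y\<close> by uniqueness. The opposite bound
    follows by applying this to \<open>- f\<close>.\<close>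
  have one: "eventually (\<lambda>i. f (x (s i)) < f y + e) sequentially"
    if f: "bounded_linear f" and e: "0 < e" for f :: "'a \<Rightarrow> real" and e
  proof (rule ccontr)
    assume "\<not> ?thesis"
    then obtain r :: "nat \<Rightarrow> nat" where r: "strict_mono r" "\<And>i. f y + e \<le> f (x (s (r i)))"
      using not_eventually_sequentiallyD[of "\<lambda>i. f (x (s i)) < f y + e"] by (auto simp: not_less)
    obtain z where z: "z \<in> C"
      "\<And>S. closed S \<Longrightarrow> convex S \<Longrightarrow> eventually (\<lambda>i. x (s (r i)) \<in> S) sequentially \<Longrightarrow> z \<in> S"
      using weak_cluster_point[OF C, of "\<lambda>i. x (s (r i))"] x by blast
    have "z = y" by (rule uniq) (use cluster[OF r(1) z(2)] y_cl in auto)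
    moreover have "z \<in> f -` {f y + e ..}"
    proof (rule z(2))
      show "closed (f -` {f y + e ..})"
        using f linear_continuous_on by (intro closed_vimage) auto
      show "convex (f -` {f y + e ..})"
        using f by (intro convex_linear_vimage bounded_linear.linear) auto
    qed (use r in auto)
    ultimately show False using e by simp
  qed
  have "weak_limit (\<lambda>i. x (s i)) y"
    unfolding weak_limit_def
  proof (intro allI impI order_tendstoI)
    fix f :: "'a \<Rightarrow> real" and a assume f: "bounded_linear f"
    show "eventually (\<lambda>i. f (x (s i)) < a) sequentially" if "f y < a"
      using one[OF f, of "a - f y"] that by simp
    have "bounded_linear (\<lambda>v. - f v)" using f by (rule bounded_linear_minus)
    then show "eventually (\<lambda>i. a < f (x (s i))) sequentially" if "a < f y"
      using one[of "\<lambda>v. - f v" "f y - a"] that by simp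
  qed
  then show ?thesis using that y(1) s by blast
qed

section \<open>Minimal invariant sets\<close>

definition minimal_invariant :: "('a::real_normed_vector \<Rightarrow> 'a) \<Rightarrow> 'a set \<Rightarrow> bool" where
  "minimal_invariant T K \<longleftrightarrow> K \<noteq> {} \<and> closed K \<and> convex K \<and> T ` K \<subseteq> K \<and>
     (\<forall>S. S \<subseteq> K \<and> S \<noteq> {} \<and> closed S \<and> convex S \<and> T ` S \<subseteq> S \<longrightarrow> S = K)"

text \<open>Zorn's lemma for reversed inclusion: closed convex sets are weakly closed, so weak
  compactness of \<open>C\<close> makes the intersection of a chain nonempty.\<close>

lemma minimal_invariant_exists:
  fixes C :: "'a::real_normed_vector set"
  assumes C: "weakly_compact C" "convex C" "C \<noteq> {}" "T ` C \<subseteq> C"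
  obtains K where "K \<subseteq> C" "minimal_invariant T K"
proof -
  let ?A = "{S. S \<subseteq> C \<and> S \<noteq> {} \<and> closed S \<and> convex S \<and> T ` S \<subseteq> S}"
  have "\<exists>m\<in>?A. \<forall>a\<in>?A. m \<supseteq> a \<longrightarrow> a = m"
  proof (rule predicate_Zorn)
    show "partial_order_on ?A (relation_of (\<supseteq>) ?A)"
      by (rule partial_order_on_relation_ofI) auto
  next
    fix \<C> assume \<C>: "\<C> \<in> Chains (relation_of (\<supseteq>) ?A)"
    then have sub: "\<C> \<subseteq> ?A" by (rule Chains_relation_of)
    have ch: "S \<subseteq> S' \<or> S' \<subseteq> S" if "S \<in> \<C>" "S' \<in> \<C>" for S S'
      using \<C> that unfolding Chains_def relation_of_def by auto
    show "\<exists>u\<in>?A. \<forall>a\<in>\<C>. u \<subseteq> a"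
    proof (cases "\<C> = {}")
      case True
      have "C \<in> ?A" using C weakly_compact_imp_closed by auto
      then show ?thesis using True by blast
    next
      case False
      have "C \<inter> \<Inter>\<C> \<noteq> {}"
      proof (rule weakly_compact_Inter[OF C(1)])
        fix S assume "S \<in> \<C>" then show "closed S \<and> convex S" using sub by blast
      next
        fix \<G> assume "finite \<G>" "\<G> \<subseteq> \<C>"
        \<comment> \<open>A finite part of a chain has a lower bound inside the chain; for the empty
          part any member of \<open>\<C>\<close> is taken.\<close>
        then have "\<exists>S\<in>\<C>. \<forall>S'\<in>\<G>. S \<subseteq> S'"
        proof (induction rule: finite_induct)
          case empty then show ?case using False by blast
        next
          case (insert S' \<G>)
          then obtain S where S: "S \<in> \<C>" "\<forall>S'\<in>\<G>. S \<subseteq> S'" by auto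
          moreover have "S' \<in> \<C>" using insert by auto
          ultimately show ?case using ch[of S S'] by (metis insert_iff order_trans order_refl)
        qed
        then obtain S where S: "S \<in> \<C>" "S \<subseteq> \<Inter>\<G>" by blast
        then have "S \<noteq> {}" "S \<subseteq> C" using sub by auto
        then show "C \<inter> \<Inter>\<G> \<noteq> {}" using S(2) by blast
      qed
      moreover have "C \<inter> \<Inter>\<C> = \<Inter>\<C>" using False sub by blast
      moreover have "closed (\<Inter>\<C>)" using sub by (intro closed_Inter) auto
      moreover have "convex (\<Inter>\<C>)" using sub by (intro convex_Inter) auto
      moreover have "T ` (\<Inter>\<C>) \<subseteq> \<Inter>\<C>" using sub by blast
      ultimately have "\<Inter>\<C> \<in> ?A" by blast
      then show ?thesis by (intro bexI[of _ "\<Inter>\<C>"]) auto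
    qed
  qed
  then obtain K where K: "K \<in> ?A" "\<And>S. S \<in> ?A \<Longrightarrow> S \<subseteq> K \<Longrightarrow> S = K" by auto
  have "minimal_invariant T K"
    unfolding minimal_invariant_def using K(1) K(2) by (auto simp: subset_trans)
  then show ?thesis using that K(1) by blast
qed

lemma minimal_invariantD:
  assumes "minimal_invariant T K"
  shows "K \<noteq> {}" "closed K" "convex K" "T ` K \<subseteq> K"
    and "\<And>S. S \<subseteq> K \<Longrightarrow> S \<noteq> {} \<Longrightarrow> closed S \<Longrightarrow> convex S \<Longrightarrow> T ` S \<subseteq> S \<Longrightarrow> S = K"
  using assms unfolding minimal_invariant_def by auto

lemma nonexpansive_on_subset:
  "nonexpansive_on C T \<Longrightarrow> K \<subseteq> C \<Longrightarrow> T ` K \<subseteq> K \<Longrightarrow> nonexpansive_on K T"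
  unfolding nonexpansive_on_def by blast

text \<open>Otherwise the points of \<open>K\<close> within \<open>r < diameter K\<close> of all of
  \<open>K\<close> form a nonempty closed convex invariant set. By minimality this set is
  \<open>K\<close>, so \<open>diameter K \<le> r\<close>.\<close>

lemma minimal_invariant_diametral:
  fixes K :: "'a::real_normed_vector set"
  assumes K: "minimal_invariant T K" and ne: "nonexpansive_on K T" and z: "z \<in> K" and e: "0 < e"
  obtains y where "y \<in> K" "diameter K - e < dist z y"
proof (rule ccontr)
  note minK = minimal_invariantD[OF K]
  assume "\<not> thesis"
  then have le: "\<forall>y\<in>K. dist z y \<le> diameter K - e" using that not_le by blast
  define r where "r = diameter K - e"
  let ?S = "K \<inter> (\<Inter>y\<in>K. cball y r)"
  have "T x \<in> ?S" if x: "x \<in> ?S" for x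
  proof -
    \<comment> \<open>Nonexpansiveness only places \<open>T\<close> K\<open>near\<close>T
      x\<open>. Since\<close>?B\<open>contains\<close>T \<open>K\<close>, it is invariant, and
      minimality then places all of \<open>K\<close> near \<open>T x\<close>.\<close>
    let ?B = "K \<inter> cball (T x) r"
    have Tx: "T x \<in> K" using x minK(4) by auto
    have "T y \<in> cball (T x) r" if "y \<in> K" for y
    proof -
      have "norm (T x - T y) \<le> norm (x - y)" using ne x that by (auto simp: nonexpansive_on_def)
      also have "\<dots> \<le> r" using x that by (auto simp: dist_norm norm_minus_commute)
      finally show ?thesis by (simp add: dist_norm)
    qed
    then have TK: "T ` K \<subseteq> ?B" using minK(4) by auto
    have "?B = K"
    proof (rule minK(5))
      show "?B \<noteq> {}" using TK minK(1) by blast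
    qed (use minK TK in \<open>auto intro!: closed_Int convex_Int\<close>)
    then show ?thesis using Tx by (force simp: dist_commute)
  qed
  then have "?S = K"
    using le z minK by (intro minK(5)) (auto intro!: closed_Int convex_Int convex_INT simp: r_def dist_commute)
  then have xy: "dist x y \<le> r" if "x \<in> K" "y \<in> K" for x y using that by (force simp: dist_commute)
  have "0 \<le> r" using xy[OF z z] by simp
  then have "diameter K \<le> r" using xy by (intro diameter_le) (auto simp: dist_norm)
  then show False using e by (simp add: r_def)
qed

section \<open>Norms of partial sums over windows\<close>

lemma subset_sum_sup_le_iff:
  "subset_sum_sup n v y i \<le> c \<longleftrightarrow> (\<forall>A. A \<subseteq> {1..n} \<longrightarrow> norm (\<Sum>k\<in>A. v (i + k) - y) \<le> c)"
  unfolding subset_sum_sup_def by (subst Max_le_iff) auto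

text \<open>At most \<open>n\<close> summands change, each by at most \<open>\<delta>\<close>. The
  hypothesis covers both later uses: moving the centre \<open>y\<close>, and replacing the sequence
  \<open>T \<circ> u\<close> by \<open>u\<close>.\<close>

lemma subset_sum_sup_perturb:
  assumes "\<And>k. norm ((v' k - y') - (v k - y)) \<le> \<delta>"
  shows "subset_sum_sup n v' y' i \<le> subset_sum_sup n v y i + real n * \<delta>"
  unfolding subset_sum_sup_le_iff
proof (intro allI impI)
  fix A assume A: "A \<subseteq> {1..n}"
  have \<delta>: "0 \<le> \<delta>" using assms[of 0] norm_ge_zero order_trans by blast
  have "card A \<le> n" using card_mono[OF _ A] by simp
  have "norm (\<Sum>k\<in>A. v' (i + k) - y')
      = norm ((\<Sum>k\<in>A. v (i + k) - y) + (\<Sum>k\<in>A. (v' (i + k) - y') - (v (i + k) - y)))"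
    by (simp only: sum.distrib[symmetric]) simp
  also have "\<dots> \<le> norm (\<Sum>k\<in>A. v (i + k) - y) + norm (\<Sum>k\<in>A. (v' (i + k) - y') - (v (i + k) - y))"
    by (rule norm_triangle_ineq)
  also have "norm (\<Sum>k\<in>A. (v' (i + k) - y') - (v (i + k) - y)) \<le> real (card A) * \<delta>"
    using assms by (intro sum_norm_bound)
  also have "real (card A) * \<delta> \<le> real n * \<delta>" using \<open>card A \<le> n\<close> \<delta> by (simp add: mult_right_mono)
  also have "norm (\<Sum>k\<in>A. v (i + k) - y) \<le> subset_sum_sup n v y i"
    using subset_sum_sup_le_iff[of n v y i] A by blast
  finally show "norm (\<Sum>k\<in>A. v' (i + k) - y') \<le> subset_sum_sup n v y i + real n * \<delta>" by simp
qed

lemma subset_sum_sup_convex: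
  assumes "subset_sum_sup n v x i \<le> c" "subset_sum_sup n v y i \<le> c" "0 \<le> s" "0 \<le> t" "s + t = 1"
  shows "subset_sum_sup n v (s *\<^sub>R x + t *\<^sub>R y) i \<le> c"
  unfolding subset_sum_sup_le_iff
proof (intro allI impI)
  fix A assume A: "A \<subseteq> {1..n}"
  have eq: "w - (s *\<^sub>R x + t *\<^sub>R y) = s *\<^sub>R (w - x) + t *\<^sub>R (w - y)" for w
  proof -
    have "w = s *\<^sub>R w + t *\<^sub>R w" by (simp add: scaleR_add_left[symmetric] assms(5))
    then show ?thesis by (simp add: algebra_simps)
  qed
  have "(\<Sum>k\<in>A. v (i + k) - (s *\<^sub>R x + t *\<^sub>R y))
      = s *\<^sub>R (\<Sum>k\<in>A. v (i + k) - x) + t *\<^sub>R (\<Sum>k\<in>A. v (i + k) - y)"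
    by (simp add: eq sum.distrib scaleR_sum_right)
  also have "norm \<dots> \<le> s * norm (\<Sum>k\<in>A. v (i + k) - x) + t * norm (\<Sum>k\<in>A. v (i + k) - y)"
    using assms(3,4) by (intro norm_triangle_le) simp
  also have "\<dots> \<le> s * c + t * c"
    using assms A unfolding subset_sum_sup_le_iff by (intro add_mono mult_left_mono) auto
  also have "\<dots> = c" using assms(5) by (simp add: distrib_right[symmetric])
  finally show "norm (\<Sum>k\<in>A. v (i + k) - (s *\<^sub>R x + t *\<^sub>R y)) \<le> c" .
qed

text \<open>An eventual bound \<open>c\<close> bounds the limsup, but a limsup of at most
  \<open>c\<close> only returns the eventual bound \<open>c + e\<close>; hence the slack.\<close>

lemma cm_nonexpansive_eventually:
  fixes C :: "'a::real_normed_vector set"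
  assumes cm: "cm_nonexpansive C T" and n: "1 \<le> n" and u: "\<And>i. u i \<in> C" and y: "y \<in> C"
    and le: "eventually (\<lambda>i. subset_sum_sup n u y i \<le> c) sequentially" and e: "0 < e"
  shows "eventually (\<lambda>i. subset_sum_sup n (T \<circ> u) (T y) i \<le> c + e) sequentially"
proof -
  have "limsup (\<lambda>i. ereal (subset_sum_sup n (T \<circ> u) (T y) i))
      \<le> limsup (\<lambda>i. ereal (subset_sum_sup n u y i))"
    using cm n u y unfolding cm_nonexpansive_def by blast
  also have "\<dots> \<le> ereal c" using le by (intro Limsup_bounded) simp
  also have "\<dots> < ereal (c + e)" using e by simp
  finally have "eventually (\<lambda>i. ereal (subset_sum_sup n (T \<circ> u) (T y) i) < ereal (c + e)) sequentially"
    by (rule Limsup_lessD)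
  then show ?thesis by (auto elim: eventually_mono)
qed

text \<open>If no \<open>\<tau>\<close> works, displacement bounds tending to 0 give sequences
  \<open>U j\<close> whose window sums around \<open>p\<close> are eventually at most
  \<open>r\<close>. The centres for which this bound persists asymptotically in \<open>j\<close>
  form a closed convex invariant set, hence all of \<open>K\<close>. Averaging the windows then
  produces a point too close to all of \<open>K\<close>, against diametrality.\<close>

lemma minimal_invariant_window_sums:
  fixes C :: "'a::real_normed_vector set"
  assumes C: "weakly_compact C" and cm: "cm_nonexpansive C T" and KC: "K \<subseteq> C"
    and K: "minimal_invariant T K" and n: "1 \<le> n" and e: "0 < e" and p: "p \<in> K"
  obtains \<tau> where "0 < \<tau>"
    "\<And>u. (\<And>i::nat. u i \<in> K) \<Longrightarrow> (\<And>i. norm (T (u i) - u i) \<le> \<tau>) \<Longrightarrow>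
      \<not> eventually (\<lambda>i. subset_sum_sup n u p i \<le> real n * diameter K - e) sequentially"
proof (rule ccontr)
  assume contra: "\<not> thesis"
  note minK = minimal_invariantD[OF K]
  define r where "r = real n * diameter K - e"
  have "\<exists>u. (\<forall>i::nat. u i \<in> K) \<and> (\<forall>i. norm (T (u i) - u i) \<le> 1 / real (Suc j)) \<and>
      eventually (\<lambda>i. subset_sum_sup n u p i \<le> r) sequentially" for j
  proof (rule ccontr)
    assume none: "\<not> ?thesis"
    have thesis by (rule that[of "1 / real (Suc j)"], simp) (use none[unfolded r_def] in blast)
    then show False using contra by contradiction
  qed
  then obtain U where UK: "\<And>j i. U j i \<in> K"
    and UT: "\<And>j i. norm (T (U j i) - U j i) \<le> 1 / real (Suc j)"
    and Up: "\<And>j. eventually (\<lambda>i. subset_sum_sup n (U j) p i \<le> r) sequentially"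
    by metis
  \<comment> \<open>Two nested limits: \<open>i\<close> runs inside the sequence \<open>U j\<close>,
    then \<open>j\<close> grows. The displacement of \<open>U j\<close> is positive for fixed
    \<open>j\<close> and is absorbed by \<open>\<delta>\<close> only in the outer limit.\<close>
  define Q where "Q y \<delta> j \<longleftrightarrow> eventually (\<lambda>i. subset_sum_sup n (U j) y i \<le> r + \<delta>) sequentially" for y \<delta> j
  define E where "E = {y \<in> K. \<forall>\<delta>>0. eventually (Q y \<delta>) sequentially}"
  have "E = K"
  proof (rule minK(5))
    show "E \<subseteq> K" by (auto simp: E_def)
    have "Q p \<delta> j" if "0 < \<delta>" for \<delta> j
      unfolding Q_def using Up[of j] that by (auto elim: eventually_mono)
    then have "p \<in> E" using p by (simp add: E_def always_eventually)
    then show "E \<noteq> {}" by blast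
    show "convex E"
      unfolding convex_def
    proof (intro ballI allI impI)
      fix x y and s t :: real assume xy: "x \<in> E" "y \<in> E" and st: "0 \<le> s" "0 \<le> t" "s + t = 1"
      have "eventually (Q (s *\<^sub>R x + t *\<^sub>R y) \<delta>) sequentially" if "0 < \<delta>" for \<delta>
      proof -
        have "eventually (Q x \<delta>) sequentially" "eventually (Q y \<delta>) sequentially"
          using xy that by (auto simp: E_def)
        then show ?thesis
        proof eventually_elim
          case (elim j)
          then show ?case unfolding Q_def
            by eventually_elim (use st in \<open>blast intro: subset_sum_sup_convex\<close>)
        qed
      qed
      moreover have "s *\<^sub>R x + t *\<^sub>R y \<in> K" using xy st minK(3) by (auto simp: E_def convexD)
      ultimately show "s *\<^sub>R x + t *\<^sub>R y \<in> E" by (simp add: E_def)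
    qed
    show "closed E"
    proof (rule closure_subset_eq[THEN iffD1], rule subsetI)
      fix x assume "x \<in> closure E"
      then have x: "\<forall>e>0. \<exists>y\<in>E. dist y x < e" by (simp add: closure_approachable)
      then have "x \<in> closure K" unfolding closure_approachable E_def by blast
      then have xK: "x \<in> K" using minK(2) by simp
      have "eventually (Q x \<delta>) sequentially" if \<delta>: "0 < \<delta>" for \<delta>
      proof -
        have "0 < \<delta> / (2 * real n)" using \<delta> n by simp
        then obtain y where y: "y \<in> E" "dist y x < \<delta> / (2 * real n)" using x by blast
        then have "eventually (Q y (\<delta>/2)) sequentially" using \<delta> by (auto simp: E_def)
        then show ?thesis
        proof eventually_elim
          case (elim j)
          have "subset_sum_sup n (U j) x i \<le> subset_sum_sup n (U j) y i + real n * (\<delta> / (2 * real n))" for i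
            using y(2) by (intro subset_sum_sup_perturb) (simp add: dist_norm)
          moreover have "real n * (\<delta> / (2 * real n)) = \<delta> / 2" using n by simp
          ultimately have step: "subset_sum_sup n (U j) x i \<le> r + \<delta>"
            if "subset_sum_sup n (U j) y i \<le> r + \<delta> / 2" for i
            using that by (smt (verit) field_sum_of_halves)
          show ?case using elim unfolding Q_def by (rule eventually_mono) (rule step)
        qed
      qed
      then show "x \<in> E" using xK by (simp add: E_def)
    qed
    show "T ` E \<subseteq> E"
    proof
      fix y' assume "y' \<in> T ` E"
      then obtain y where y: "y \<in> E" "y' = T y" by blast
      have yK: "y \<in> K" using y(1) by (simp add: E_def)
      \<comment> \<open>The slack is spent in thirds: the bound at \<open>y\<close>, the slack of
        \<open>cm_nonexpansive_eventually\<close>, and the cost \<open>n / (j + 1)\<close> of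
        replacing \<open>T \<circ> U j\<close> by \<open>U j\<close>.\<close>
      have "eventually (Q (T y) \<delta>) sequentially" if \<delta>: "0 < \<delta>" for \<delta>
      proof -
        have "(\<lambda>j. real n * (1 / real (Suc j))) \<longlonglongrightarrow> real n * 0"
          by (intro tendsto_mult_left LIMSEQ_inverse_real_of_nat[unfolded inverse_eq_divide])
        then have "eventually (\<lambda>j. real n * (1 / real (Suc j)) < \<delta>/3) sequentially"
          using \<delta> by (intro order_tendstoD(2)) auto
        moreover have "eventually (Q y (\<delta>/3)) sequentially" using y(1) \<delta> by (auto simp: E_def)
        ultimately show ?thesis
        proof eventually_elim
          case (elim j)
          have "eventually (\<lambda>i. subset_sum_sup n (T \<circ> U j) (T y) i \<le> r + \<delta>/3 + \<delta>/3) sequentially"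
            using elim(2) \<delta> UK KC yK unfolding Q_def
            by (intro cm_nonexpansive_eventually[OF cm n]) auto
          moreover have near: "subset_sum_sup n (U j) (T y) i
              \<le> subset_sum_sup n (T \<circ> U j) (T y) i + real n * (1 / real (Suc j))" for i
            using UT[of j] by (intro subset_sum_sup_perturb) (simp add: norm_minus_commute)
          moreover have "subset_sum_sup n (U j) (T y) i \<le> r + \<delta>"
            if "subset_sum_sup n (T \<circ> U j) (T y) i \<le> r + \<delta>/3 + \<delta>/3" for i
            using near[of i] elim(1) that by linarith
          ultimately show ?case unfolding Q_def by (auto elim: eventually_mono)
        qed
      qed
      moreover have "T y \<in> K" using yK minK(4) by blast
      ultimately show "y' \<in> E" using y(2) by (simp add: E_def)
    qed
  qed
  \<comment> \<open>Consecutive terms need not cluster simultaneously, so take cluster points of the window averages.\<close>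
  define avg where "avg j i = (1 / real n) *\<^sub>R (\<Sum>k\<in>{1..n}. U j (i + k))" for j i
  have avgK: "avg j i \<in> K" for j i
    unfolding avg_def scaleR_sum_right using n UK minK(3) by (intro convex_sum) auto
  have avg_near: "eventually (\<lambda>i. avg j i \<in> cball y ((r + \<delta>) / real n)) sequentially"
    if "Q y \<delta> j" for y \<delta> j
    using that unfolding Q_def
  proof eventually_elim
    case (elim i)
    have "avg j i - y = (1 / real n) *\<^sub>R (\<Sum>k\<in>{1..n}. U j (i + k) - y)"
      using n by (simp add: avg_def sum_subtractf scaleR_diff_right sum_constant_scaleR del: sum_constant)
    then have "norm (avg j i - y) = norm (\<Sum>k\<in>{1..n}. U j (i + k) - y) / real n" by simp
    also have "\<dots> \<le> (r + \<delta>) / real n"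
      using elim unfolding subset_sum_sup_le_iff by (intro divide_right_mono) auto
    finally show ?case by (simp add: dist_norm norm_minus_commute)
  qed
  have "\<exists>z\<in>K. \<forall>y \<delta>. Q y \<delta> j \<longrightarrow> z \<in> cball y ((r + \<delta>) / real n)" for j
  proof -
    obtain z where z: "\<And>S. closed S \<Longrightarrow> convex S \<Longrightarrow> eventually (\<lambda>i. avg j i \<in> S) sequentially \<Longrightarrow> z \<in> S"
      using weak_cluster_point[OF C, of "avg j"] subsetD[OF KC avgK] by metis
    have "z \<in> K" using minK(2,3) avgK by (intro z) auto
    moreover have "z \<in> cball y ((r + \<delta>) / real n)" if "Q y \<delta> j" for y \<delta>
      using avg_near[OF that] by (intro z) auto
    ultimately show ?thesis by blast
  qed
  then obtain Z where ZK: "\<And>j. Z j \<in> K"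
    and Z: "\<And>j y \<delta>. Q y \<delta> j \<Longrightarrow> Z j \<in> cball y ((r + \<delta>) / real n)" by metis
  \<comment> \<open>The slack \<open>\<delta>\<close> is available for a given centre only once
    \<open>j\<close> is large, so a second cluster point, of the \<open>Z j\<close>, is
    taken.\<close>
  obtain \<zeta> where \<zeta>: "\<And>S. closed S \<Longrightarrow> convex S \<Longrightarrow> eventually (\<lambda>j. Z j \<in> S) sequentially \<Longrightarrow> \<zeta> \<in> S"
    using weak_cluster_point[OF C, of Z] subsetD[OF KC ZK] by metis
  have \<zeta>K: "\<zeta> \<in> K" using minK(2,3) ZK by (intro \<zeta>) auto
  have ne: "nonexpansive_on K T"
    using cm KC minK(4) by (auto simp: cm_nonexpansive_def intro: nonexpansive_on_subset)
  \<comment> \<open>With slack \<open>e/2\<close> the radius \<open>(r + e/2) / n\<close> equals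
    \<open>diameter K - e / (2 n)\<close>, and every point of \<open>K\<close> lies within it of
    \<open>\<zeta>\<close>.\<close>
  obtain y where y: "y \<in> K" "diameter K - e / (2 * real n) < dist \<zeta> y"
    using minimal_invariant_diametral[OF K ne \<zeta>K, of "e / (2 * real n)"] e n by auto
  have "y \<in> E" using y(1) \<open>E = K\<close> by simp
  then have "eventually (Q y (e/2)) sequentially" using e by (simp add: E_def)
  then have "eventually (\<lambda>j. Z j \<in> cball y ((r + e/2) / real n)) sequentially"
    by (rule eventually_mono) (rule Z)
  then have "\<zeta> \<in> cball y ((r + e/2) / real n)" by (intro \<zeta>) auto
  then have "dist \<zeta> y \<le> (real n * diameter K - e / 2) / real n"
    by (simp add: r_def dist_commute)
  then show False using y(2) n by (simp add: field_simps)
qed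

section \<open>Separated tuples from nearly extremal sums\<close>

lemma Ramsey_dichotomy:
  fixes H :: "'a set" and P :: "'a set \<Rightarrow> bool"
  assumes "infinite H"
  obtains H' where "H' \<subseteq> H" "infinite H'"
    "(\<forall>F. F \<subseteq> H' \<and> finite F \<and> card F = r \<longrightarrow> P F) \<or> (\<forall>F. F \<subseteq> H' \<and> finite F \<and> card F = r \<longrightarrow> \<not> P F)"
proof -
  have "\<exists>Y t. Y \<subseteq> H \<and> infinite Y \<and> t < 2 \<and>
      (\<forall>X. X \<subseteq> Y \<and> finite X \<and> card X = r \<longrightarrow> of_bool (P X) = (t::nat))"
    by (rule Ramsey[OF assms]) (auto simp: of_bool_def)
  then obtain Y t where Y: "Y \<subseteq> H" "infinite Y"
    and t: "\<forall>X. X \<subseteq> Y \<and> finite X \<and> card X = r \<longrightarrow> of_bool (P X) = (t::nat)"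
    by blast
  show ?thesis
  proof (cases "t = 1")
    case True
    then show ?thesis using t by (intro that[OF Y] disjI1) (metis of_bool_eq_1_iff)
  next
    case False
    then show ?thesis using t by (intro that[OF Y] disjI2) (metis of_bool_eq(2))
  qed
qed

lemma infinite_nat_subset_above:
  fixes H :: "nat set"
  assumes "infinite H"
  obtains F where "F \<subseteq> H" "finite F" "card F = r" "\<And>i. i \<in> F \<Longrightarrow> m < i"
proof -
  have "infinite (H - {..m})" using assms by simp
  then obtain F where "F \<subseteq> H - {..m}" "finite F" "card F = r"
    using infinite_arbitrarily_large by metis
  then show ?thesis by (intro that[of F]) auto
qed

lemma Min_insert_below: "finite F \<Longrightarrow> (\<And>i. i \<in> F \<Longrightarrow> j < i) \<Longrightarrow> Min (insert j F) = (j::'a::linorder)"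
  by (rule Min_eqI) (auto intro: less_imp_le)

lemma Max_insert_above: "finite F \<Longrightarrow> (\<And>i. i \<in> F \<Longrightarrow> i < j) \<Longrightarrow> Max (insert j F) = (j::'a::linorder)"
  by (rule Max_eqI) (auto intro: less_imp_le)

text \<open>By Mazur's theorem a convex combination of the \<open>a j\<close> with
  \<open>j \<in> H\<close> has norm below \<open>e\<close>, and a functional at least
  \<open>e\<close> on its whole support would be at least \<open>e\<close> on it. The support
  \<open>J\<close> is chosen before the functional, which is what makes the lemma useful.\<close>

lemma weakly_null_no_lower_bound:
  fixes a :: "nat \<Rightarrow> 'a::real_normed_vector"
  assumes a: "weak_limit a 0" and H: "infinite H" and e: "0 < e"
  obtains J where "finite J" "J \<subseteq> H"
    "\<And>f. bounded_linear f \<Longrightarrow> (\<And>v. \<bar>f v\<bar> \<le> norm v) \<Longrightarrow> \<exists>j\<in>J. f (a j) < (e::real)"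
proof -
  have "frequently (\<lambda>n. a n \<in> closure (convex hull (a ` H))) sequentially"
    unfolding frequently_sequentially
  proof
    fix N
    obtain n where "n \<in> H" "n \<ge> N" using H unfolding infinite_nat_iff_unbounded_le by blast
    then show "\<exists>n\<ge>N. a n \<in> closure (convex hull (a ` H))"
      by (intro exI[of _ n] conjI subsetD[OF closure_subset] hull_inc) auto
  qed
  then have "0 \<in> closure (convex hull (a ` H))"
    by (intro weak_limit_in_closed_convex[OF a] convex_closure convex_convex_hull) auto
  then obtain v where v: "v \<in> convex hull (a ` H)" "norm v < e"
    using e unfolding closure_approachable by (auto simp: dist_norm)
  then obtain S u where S: "finite S" "S \<subseteq> a ` H" "\<And>x. x \<in> S \<Longrightarrow> 0 \<le> u x" "sum u S = 1"
    "(\<Sum>x\<in>S. u x *\<^sub>R x) = v"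
    unfolding convex_hull_explicit by auto
  obtain J where J: "finite J" "J \<subseteq> H" "S = a ` J" using S(1,2) by (meson finite_subset_image)
  have "\<exists>j\<in>J. f (a j) < e" if f: "bounded_linear f" "\<And>v. \<bar>f v\<bar> \<le> norm v" for f
  proof (rule ccontr)
    assume "\<not> ?thesis"
    then have ge: "e \<le> f x" if "x \<in> S" for x using that J(3) by (auto simp: not_less)
    interpret bounded_linear f by (rule f(1))
    have "e = (\<Sum>x\<in>S. u x * e)" using S(4) by (simp add: sum_distrib_right[symmetric])
    also have "\<dots> \<le> (\<Sum>x\<in>S. u x * f x)" using ge S(3) by (intro sum_mono mult_left_mono) auto
    also have "\<dots> = f v" by (simp add: S(5)[symmetric] sum scaleR)
    also have "\<dots> \<le> norm v" using f(2)[of v] by simp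
    finally show False using v(2) by simp
  qed
  then show ?thesis using that J by blast
qed

text \<open>Ramsey's theorem is applied to sets of size \<open>Suc r\<close>, viewed as an
  \<open>r\<close>-set with an extra minimum (\<open>P\<close>) or maximum (\<open>R\<close>). Weak
  nullness of \<open>a\<close> rules out the bad colour each time.\<close>

lemma Ramsey_functionals_small_off:
  fixes a :: "nat \<Rightarrow> 'a::real_normed_vector" and \<Phi> :: "nat set \<Rightarrow> 'a \<Rightarrow> real"
  assumes a: "weak_limit a 0" and \<Phi>: "\<And>F. bounded_linear (\<Phi> F)" "\<And>F v. \<bar>\<Phi> F v\<bar> \<le> norm v"
    and H: "infinite H" and e: "0 < e"
  obtains H' where "H' \<subseteq> H" "infinite H'"
    "\<forall>F j. F \<subseteq> H' \<and> finite F \<and> card F = r \<and> j \<in> H' \<and>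
      ((\<forall>i\<in>F. j < i) \<or> (\<forall>i\<in>F. i < j)) \<longrightarrow> \<Phi> F (a j) < e"
proof -
  define P where "P S \<longleftrightarrow> \<Phi> (S - {Min S}) (a (Min S)) < e" for S
  define R where "R S \<longleftrightarrow> \<Phi> (S - {Max S}) (a (Max S)) < e" for S
  have Pins: "P (insert j F) \<longleftrightarrow> \<Phi> F (a j) < e" if "finite F" "\<And>i. i \<in> F \<Longrightarrow> j < i" for j F
  proof -
    have "insert j F - {j} = F" using that(2) by blast
    then show ?thesis using Min_insert_below[OF that] by (simp add: P_def)
  qed
  have Rins: "R (insert j F) \<longleftrightarrow> \<Phi> F (a j) < e" if "finite F" "\<And>i. i \<in> F \<Longrightarrow> i < j" for j F
  proof -
    have "insert j F - {j} = F" using that(2) by blast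
    then show ?thesis using Max_insert_above[OF that] by (simp add: R_def)
  qed
  obtain H1 where H1: "H1 \<subseteq> H" "infinite H1"
    and P: "(\<forall>F. F \<subseteq> H1 \<and> finite F \<and> card F = Suc r \<longrightarrow> P F) \<or> (\<forall>F. F \<subseteq> H1 \<and> finite F \<and> card F = Suc r \<longrightarrow> \<not> P F)"
    using Ramsey_dichotomy[OF H, of "Suc r" P] by blast
  obtain H2 where H2: "H2 \<subseteq> H1" "infinite H2"
    and R: "(\<forall>F. F \<subseteq> H2 \<and> finite F \<and> card F = Suc r \<longrightarrow> R F) \<or> (\<forall>F. F \<subseteq> H2 \<and> finite F \<and> card F = Suc r \<longrightarrow> \<not> R F)"
    using Ramsey_dichotomy[OF H1(2), of "Suc r" R] by blast
  have "\<not> (\<forall>F. F \<subseteq> H1 \<and> finite F \<and> card F = Suc r \<longrightarrow> \<not> P F)"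
  proof
    assume bad: "\<forall>F. F \<subseteq> H1 \<and> finite F \<and> card F = Suc r \<longrightarrow> \<not> P F"
    obtain J where J: "finite J" "J \<subseteq> H1"
      "\<And>f. bounded_linear f \<Longrightarrow> (\<And>v. \<bar>f v\<bar> \<le> norm v) \<Longrightarrow> \<exists>j\<in>J. f (a j) < e"
      using weakly_null_no_lower_bound[OF a H1(2) e] by blast
    obtain m where m: "\<forall>j\<in>J. j \<le> m" using J(1) finite_nat_set_iff_bounded_le by auto
    \<comment> \<open>The functional \<open>\<Phi> F\<close> varies with \<open>F\<close>, so
      ordinary weak convergence does not control the points before \<open>F\<close>. Instead
      \<open>J\<close> is fixed first, \<open>F\<close> is taken beyond it, and some index in
      \<open>J\<close> is small for whichever functional results.\<close>
    obtain F where F: "F \<subseteq> H1" "finite F" "card F = r" "\<And>i. i \<in> F \<Longrightarrow> m < i"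
      using infinite_nat_subset_above[OF H1(2), of r m] by blast
    obtain j where j: "j \<in> J" "\<Phi> F (a j) < e" using J(3)[OF \<Phi>(1,2)] by blast
    have below: "j < i" if "i \<in> F" for i using F(4)[OF that] m j(1) by fastforce
    then have "card (insert j F) = Suc r" using F(2,3) by (subst card_insert_disjoint) auto
    then have "\<not> P (insert j F)" using bad F(1,2) J(2) j(1) by auto
    then show False using Pins[OF F(2) below] j(2) by simp
  qed
  then have P: "\<forall>F. F \<subseteq> H1 \<and> finite F \<and> card F = Suc r \<longrightarrow> P F" using P by blast
  have "\<not> (\<forall>F. F \<subseteq> H2 \<and> finite F \<and> card F = Suc r \<longrightarrow> \<not> R F)"
  proof
    assume bad: "\<forall>F. F \<subseteq> H2 \<and> finite F \<and> card F = Suc r \<longrightarrow> \<not> R F"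
    obtain F where F: "F \<subseteq> H2" "finite F" "card F = r"
      using infinite_nat_subset_above[OF H2(2), of r 0] by blast
    obtain m where m: "\<forall>i\<in>F. i \<le> m" using F(2) finite_nat_set_iff_bounded_le by auto
    \<comment> \<open>For points after \<open>F\<close> the functional is already fixed, so weak
      convergence suffices.\<close>
    have "(\<lambda>n. \<Phi> F (a n)) \<longlonglongrightarrow> \<Phi> F 0" using a \<Phi>(1) by (simp add: weak_limit_def)
    then have "(\<lambda>n. \<Phi> F (a n)) \<longlonglongrightarrow> 0"
      by (simp add: linear_0[OF bounded_linear.linear[OF \<Phi>(1)]])
    then have "eventually (\<lambda>n. \<Phi> F (a n) < e) sequentially" using e by (rule order_tendstoD(2))
    then obtain N where N: "\<And>n. N \<le> n \<Longrightarrow> \<Phi> F (a n) < e" by (auto simp: eventually_sequentially)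
    obtain j where j: "j \<in> H2" "max N (Suc m) \<le> j"
      using H2(2) unfolding infinite_nat_iff_unbounded_le by blast
    have above: "i < j" if "i \<in> F" for i using m j(2) that by fastforce
    then have "card (insert j F) = Suc r" using F(2,3) by (subst card_insert_disjoint) auto
    then have "\<not> R (insert j F)" using bad F(1,2) j(1) by auto
    then show False using Rins[OF F(2) above] N[of j] j(2) by simp
  qed
  then have R: "\<forall>F. F \<subseteq> H2 \<and> finite F \<and> card F = Suc r \<longrightarrow> R F" using R by blast
  show ?thesis
  proof (rule that[of H2])
    show "H2 \<subseteq> H" "infinite H2" using H1 H2 by auto
    have "\<Phi> F (a j) < e" if F: "F \<subseteq> H2" "finite F" "card F = r" and j: "j \<in> H2"
      and off: "(\<forall>i\<in>F. j < i) \<or> (\<forall>i\<in>F. i < j)" for F j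
      using off
    proof
      assume 1: "\<forall>i\<in>F. j < i"
      then have "card (insert j F) = Suc r" using F(2,3) by (subst card_insert_disjoint) auto
      then have "P (insert j F)" using P F j H2(1) by blast
      then show ?thesis using Pins[OF F(2)] 1 by blast
    next
      assume 2: "\<forall>i\<in>F. i < j"
      then have "card (insert j F) = Suc r" using F(2,3) by (subst card_insert_disjoint) auto
      then have "R (insert j F)" using R F j by blast
      then show ?thesis using Rins[OF F(2)] 2 by blast
    qed
    then show "\<forall>F j. F \<subseteq> H2 \<and> finite F \<and> card F = r \<and> j \<in> H2 \<and>
      ((\<forall>i\<in>F. j < i) \<or> (\<forall>i\<in>F. i < j)) \<longrightarrow> \<Phi> F (a j) < e" by blast
  qed
qed

text \<open>The sum consists of \<open>2 * card F\<close> values of \<open>f\<close>, each at most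
  1. Their total defect is at most \<open>e\<close>, hence so is each single defect.\<close>

lemma functional_near_norming:
  fixes a :: "'i \<Rightarrow> 'a::real_normed_vector"
  assumes f: "bounded_linear f" "\<And>v. \<bar>f v\<bar> \<le> norm v"
    and a: "\<And>j. norm (a j) \<le> 1" and b: "norm b \<le> 1" and F: "finite F" and i: "i \<in> F"
    and ge: "2 * real (card F) - e \<le> f (\<Sum>j\<in>F. a j + b)"
  shows "1 - e \<le> f (a i)" "1 - e \<le> f b"
proof -
  interpret bounded_linear f by (rule f(1))
  have le1: "f (a j) \<le> 1" "f b \<le> 1" for j
    using f(2)[of "a j"] a[of j] f(2)[of b] b by auto
  have "(\<Sum>j\<in>F. (1 - f (a j)) + (1 - f b)) \<le> e"
    using ge by (simp add: sum add sum.distrib sum_subtractf sum_negf)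
  moreover have "(1 - f (a i)) + (1 - f b) \<le> (\<Sum>j\<in>F. (1 - f (a j)) + (1 - f b))"
  proof (rule member_le_sum[OF i _ F])
    show "0 \<le> (1 - f (a j)) + (1 - f b)" for j using le1(1)[of j] le1(2) by simp
  qed
  ultimately show "1 - e \<le> f (a i)" "1 - e \<le> f b" using le1(1)[of i] le1(2) by auto
qed

lemma separated_tuple_from_good_sums:
  fixes a :: "nat \<Rightarrow> 'a::real_normed_vector"
  assumes k: "1 \<le> k" and e: "0 < e" and a: "weak_limit a 0"
    and an: "\<And>j. norm (a j) \<le> 1" and ad: "\<And>i j. norm (a i - a j) \<le> 1" and b: "norm b \<le> 1"
    and H: "infinite H"
    and good: "\<And>F. F \<subseteq> H \<Longrightarrow> finite F \<Longrightarrow> card F = k \<Longrightarrow> 2 * real k - e \<le> norm (\<Sum>j\<in>F. a j + b)"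
  obtains v :: "nat \<Rightarrow> 'a" where "sep_tuple k (2 - 4 * e) v"
    "1 - 2 * e \<le> norm ((1 / real (k + 1)) *\<^sub>R (\<Sum>i\<le>k. v i))"
proof -
  have "\<forall>F. \<exists>f. bounded_linear f \<and> (\<forall>v. \<bar>f v\<bar> \<le> norm v) \<and> f (\<Sum>j\<in>F. a j + b) = norm (\<Sum>j\<in>F. a j + b)"
    using norming_functional by blast
  from choice[OF this] obtain \<Phi> :: "nat set \<Rightarrow> 'a \<Rightarrow> real" where \<Phi>: "\<And>F. bounded_linear (\<Phi> F)"
    "\<And>F v. \<bar>\<Phi> F v\<bar> \<le> norm v" "\<And>F. \<Phi> F (\<Sum>j\<in>F. a j + b) = norm (\<Sum>j\<in>F. a j + b)"
    by blast
  obtain H' where H': "H' \<subseteq> H" "infinite H'" and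
    off: "\<forall>F j. F \<subseteq> H' \<and> finite F \<and> card F = k \<and> j \<in> H' \<and>
      ((\<forall>i\<in>F. j < i) \<or> (\<forall>i\<in>F. i < j)) \<longrightarrow> \<Phi> F (a j) < e"
    by (rule Ramsey_functionals_small_off[where \<Phi> = \<Phi>, OF a \<Phi>(1,2) H e, of k])
  define r where "r = enumerate H'"
  have r: "strict_mono r" "\<And>n. r n \<in> H'"
    unfolding r_def using H'(2) by (auto simp: strict_mono_enumerate enumerate_in_set)
  \<comment> \<open>Window \<open>t\<close> contains \<open>r (k + s)\<close> for \<open>s < t\<close> and \<open>r s\<close> for \<open>t \<le> s\<close>; so \<open>\<Phi> (W t)\<close> separates \<open>w s\<close> from \<open>w t\<close>
    (\<open>s < t\<close>), \<open>\<Phi> (W 0)\<close> separates \<open>b\<close> from \<open>w s\<close>, and \<open>\<Phi> (W k)\<close> norms the sum.\<close>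
  define W where "W t = r ` {t..<t + k}" for t
  define f where "f t = \<Phi> (W t)" for t
  have W: "W t \<subseteq> H'" "finite (W t)" "card (W t) = k" for t
    using r by (auto simp: W_def card_image strict_mono_imp_inj_on)
  have lin: "f t (x + y) = f t x + f t y" "f t (x - y) = f t x - f t y" for t x y
    using bounded_linear.linear[OF \<Phi>(1)[of "W t"]] by (auto simp: f_def linear_add linear_diff)
  have fn: "f t x \<le> norm x" for t x using \<Phi>(2)[of "W t" x] by (simp add: f_def)
  have on: "1 - e \<le> f t (a (r i))" "1 - e \<le> f t b" if "t \<le> i" "i < t + k" for t i
  proof -
    have ge: "2 * real (card (W t)) - e \<le> \<Phi> (W t) (\<Sum>j\<in>W t. a j + b)"
      using good[of "W t"] W[of t] H'(1) \<Phi>(3)[of "W t"] by auto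
    have "r i \<in> W t" using that by (auto simp: W_def)
    from functional_near_norming[where f = "\<Phi> (W t)" and a = a, OF \<Phi>(1,2) an b W(2) this ge]
    show "1 - e \<le> f t (a (r i))" "1 - e \<le> f t b" by (simp_all add: f_def)
  qed
  have off: "f t (a (r i)) < e" if "i < t \<or> t + k \<le> i" for t i
  proof -
    have "(\<forall>j\<in>W t. r i < j) \<or> (\<forall>j\<in>W t. j < r i)"
      using that strict_mono_less[OF r(1)] by (auto simp: W_def)
    then show ?thesis unfolding f_def using off W r(2) by simp
  qed
  define w where "w s = a (r (k + s)) - a (r s)" for s
  define v where "v i = (case i of 0 \<Rightarrow> b | Suc s \<Rightarrow> w s)" for i
  have ww: "2 - 4 * e \<le> norm (w s - w t)" if st: "s < t" "t < k" for s t
  proof -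
    \<comment> \<open>Indices \<open>k + s\<close> and \<open>t\<close> lie in window
      \<open>t\<close>, while \<open>s\<close> lies before it and \<open>k + t\<close> just after
      it. Each of the four terms costs \<open>e\<close>.\<close>
    have "2 - 4 * e \<le> f t (w s - w t)"
      using on(1)[of t "k + s"] on(1)[of t t] off[of s t] off[of "k + t" t] st
      by (simp add: w_def lin)
    then show ?thesis using fn[of t "w s - w t"] by simp
  qed
  have bw: "2 - 4 * e \<le> norm (b - w s)" if "s < k" for s
  proof -
    \<comment> \<open>Only three terms occur here, so the loss is \<open>3 * e\<close>, within the
      common bound.\<close>
    have "2 - 4 * e \<le> f 0 (b - w s)"
      using on[of 0 s] off[of "k + s" 0] that e by (simp add: w_def lin)
    then show ?thesis using fn[of 0 "b - w s"] by simp
  qed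
  have vlt: "2 - 4 * e \<le> norm (v i - v j)" if "i < j" "j \<le> k" for i j
    using that bw ww by (auto simp: v_def split: nat.splits)
  have "2 - 4 * e \<le> norm (v i - v j)" if "i \<noteq> j" "i \<le> k" "j \<le> k" for i j
    using that vlt[of i j] vlt[of j i] by (cases i j rule: linorder_cases) (auto simp: norm_minus_commute)
  moreover have "norm (v i) \<le> 1" for i
    using b ad by (auto simp: v_def w_def split: nat.splits)
  ultimately have sep: "sep_tuple k (2 - 4 * e) v" by (auto simp: sep_tuple_def)
  have "(\<Sum>i\<le>k. v i) = b + (\<Sum>s<k. w s)"
    by (simp add: lessThan_Suc_atMost[symmetric] sum.lessThan_Suc_shift v_def del: sum.lessThan_Suc)
  moreover have "f k (\<Sum>s<k. w s) = (\<Sum>s<k. f k (w s))"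
    unfolding f_def by (rule linear_sum[OF bounded_linear.linear[OF \<Phi>(1)]])
  moreover have "(\<Sum>s<k. 1 - 2 * e) \<le> (\<Sum>s<k. f k (w s))"
  proof (rule sum_mono)
    fix s assume "s \<in> {..<k}"
    then show "1 - 2 * e \<le> f k (w s)"
      using on(1)[of k "k + s"] off[of s k] by (simp add: w_def lin)
  qed
  \<comment> \<open>The bound on \<open>b\<close> comes from a window index, so the window must be
    nonempty: this uses \<open>1 \<le> k\<close>.\<close>
  moreover have "1 - e \<le> f k b" using on(2)[of k k] k by simp
  ultimately have "(1 - 2 * e) + real k * (1 - 2 * e) \<le> f k (\<Sum>i\<le>k. v i)"
    using e by (simp add: lin)
  also have "\<dots> \<le> norm (\<Sum>i\<le>k. v i)" by (rule fn)
  finally have "1 - 2 * e \<le> norm (\<Sum>i\<le>k. v i) / real (k + 1)"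
    by (simp add: field_simps)
  then have "1 - 2 * e \<le> norm ((1 / real (k + 1)) *\<^sub>R (\<Sum>i\<le>k. v i))" by simp
  from sep this show ?thesis by (rule that)
qed

section \<open>The fixed point theorem\<close>

lemma resolvent_exists:
  fixes K :: "'a::banach set"
  assumes K: "closed K" "convex K" and ne: "nonexpansive_on K T" and x: "x \<in> K" and t: "0 < t" "t < 1"
  obtains z where "z \<in> K" "z = (1 - t) *\<^sub>R T z + t *\<^sub>R x"
proof -
  let ?f = "\<lambda>z. (1 - t) *\<^sub>R T z + t *\<^sub>R x"
  have TK: "T z \<in> K" if "z \<in> K" for z using ne that by (auto simp: nonexpansive_on_def)
  have "\<exists>!z\<in>K. ?f z = z"
  proof (rule Banach_fix)
    show "complete K" using K(1) by (simp add: complete_eq_closed)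
    show "K \<noteq> {}" using x by blast
    show "?f ` K \<subseteq> K"
      using t by (intro image_subsetI convexD[OF K(2) TK x]) simp_all
    show "0 \<le> 1 - t" "1 - t < 1" using t by auto
    fix y z assume "y \<in> K" "z \<in> K"
    then have "norm (T y - T z) \<le> norm (y - z)" using ne by (auto simp: nonexpansive_on_def)
    then show "dist (?f y) (?f z) \<le> (1 - t) * dist y z"
      using t by (simp add: dist_norm scaleR_diff_right[symmetric] mult_left_mono)
  qed
  then obtain z where "z \<in> K" "?f z = z" by blast
  then show ?thesis by (intro that[of z]) simp_all
qed

lemma resolvent_displacement:
  fixes x :: "'a::real_normed_vector"
  assumes "z = (1 - t) *\<^sub>R y + t *\<^sub>R x" "0 < t" "norm (y - x) \<le> d"
  shows "norm (y - z) \<le> t * d"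
proof -
  have "y - z = t *\<^sub>R (y - x)" unfolding assms(1) by (simp add: algebra_simps)
  then show ?thesis using assms(2,3) by (simp add: mult_left_mono)
qed

text \<open>The difference is a convex combination of \<open>T z - T z'\<close> and
  \<open>x - x'\<close>; the part \<open>(1 - t) * norm (z - z')\<close> is absorbed on the left and
  \<open>t\<close> cancels.\<close>

lemma resolvent_contracts:
  fixes T :: "'a::real_normed_vector \<Rightarrow> 'a"
  assumes ne: "nonexpansive_on K T" and K: "z \<in> K" "z' \<in> K" and t: "0 < t"  "t < 1"
    and z: "z = (1 - t) *\<^sub>R T z + t *\<^sub>R x" and z': "z' = (1 - t) *\<^sub>R T z' + t *\<^sub>R x'"
  shows "norm (z - z') \<le> norm (x - x')"
proof -
  have "z - z' = (1 - t) *\<^sub>R (T z - T z') + t *\<^sub>R (x - x')"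
    by (subst z, subst z') (simp add: algebra_simps)
  then have "norm (z - z') \<le> (1 - t) * norm (T z - T z') + t * norm (x - x')"
    using t norm_triangle_ineq[of "(1 - t) *\<^sub>R (T z - T z')" "t *\<^sub>R (x - x')"] by simp
  also have "\<dots> \<le> (1 - t) * norm (z - z') + t * norm (x - x')"
    using ne K t by (auto simp: nonexpansive_on_def intro!: mult_left_mono)
  finally have "t * norm (z - z') \<le> t * norm (x - x')" by (simp add: algebra_simps)
  then show ?thesis using t by simp
qed

text \<open>The same absorption, with a nearly fixed point \<open>w\<close> in place of a second
  resolvent. The error is divided by \<open>t\<close>, so \<open>t\<close> stays fixed while the
  displacement of \<open>w\<close> tends to 0.\<close>

lemma resolvent_near:
  fixes T :: "'a::real_normed_vector \<Rightarrow> 'a"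
  assumes ne: "nonexpansive_on K T" and K: "z \<in> K" "w \<in> K" and t: "0 < t"  "t < 1"
    and z: "z = (1 - t) *\<^sub>R T z + t *\<^sub>R x"
  shows "norm (z - w) \<le> norm (x - w) + norm (T w - w) / t"
proof -
  have "z - w = (1 - t) *\<^sub>R (T z - w) + t *\<^sub>R (x - w)"
    by (subst z) (simp add: algebra_simps)
  then have "norm (z - w) \<le> (1 - t) * norm (T z - w) + t * norm (x - w)"
    using t norm_triangle_ineq[of "(1 - t) *\<^sub>R (T z - w)" "t *\<^sub>R (x - w)"] by simp
  also have "(1 - t) * norm (T z - w) \<le> (1 - t) * (norm (z - w) + norm (T w - w))"
  proof (rule mult_left_mono)
    have "norm (T z - T w) \<le> norm (z - w)" using ne K by (auto simp: nonexpansive_on_def)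
    then show "norm (T z - w) \<le> norm (z - w) + norm (T w - w)"
      using norm_triangle_ineq[of "T z - T w" "T w - w"] by simp
  qed (use t in simp)
  also have "(1 - t) * (norm (z - w) + norm (T w - w)) \<le> (1 - t) * norm (z - w) + norm (T w - w)"
    using t mult_right_mono[of "1 - t" 1 "norm (T w - w)"] by (simp add: algebra_simps)
  finally have "t * norm (z - w) \<le> t * norm (x - w) + norm (T w - w)"
    using t by (simp add: algebra_simps)
  then show ?thesis using t by (simp add: field_simps)
qed

lemma approximate_fixed_points:
  fixes K :: "'a::banach set"
  assumes K: "closed K" "convex K" "K \<noteq> {}" "bounded K" and ne: "nonexpansive_on K T"
  obtains w :: "nat \<Rightarrow> 'a" where "range w \<subseteq> K" "(\<lambda>n. norm (T (w n) - w n)) \<longlonglongrightarrow> 0"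
proof -
  obtain x where x: "x \<in> K" using K(3) by blast
  \<comment> \<open>The double successor makes \<open>t 0\<close> smaller than 1, as the contraction
    argument requires.\<close>
  define t where "t n = 1 / real (Suc (Suc n))" for n
  have t: "0 < t n" "t n < 1" for n by (auto simp: t_def)
  have "\<forall>n. \<exists>w\<in>K. w = (1 - t n) *\<^sub>R T w + t n *\<^sub>R x"
    using resolvent_exists[OF K(1,2) ne x t] by metis
  then obtain w where w: "\<And>n. w n \<in> K" "\<And>n. w n = (1 - t n) *\<^sub>R T (w n) + t n *\<^sub>R x" by metis
  have bound: "norm (T (w n) - w n) \<le> t n * diameter K" for n
  proof (rule resolvent_displacement[OF w(2) t(1)])
    have "T (w n) \<in> K" using ne w(1) by (auto simp: nonexpansive_on_def)
    then show "norm (T (w n) - x) \<le> diameter K"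
      using diameter_bounded_bound[OF K(4) _ x] by (simp add: dist_norm)
  qed
  have "(\<lambda>n. t n * diameter K) \<longlonglongrightarrow> 0 * diameter K"
    unfolding t_def
    by (intro tendsto_mult_right LIMSEQ_Suc[OF LIMSEQ_inverse_real_of_nat[unfolded inverse_eq_divide]])
  then have t0: "(\<lambda>n. t n * diameter K) \<longlonglongrightarrow> 0" by simp
  have "(\<lambda>n. norm (T (w n) - w n)) \<longlonglongrightarrow> 0"
    by (rule Lim_null_comparison[OF _ t0]) (simp add: bound)
  moreover have "range w \<subseteq> K" using w(1) by blast
  ultimately show ?thesis by (intro that)
qed

section \<open>Extraction of the tuple from a minimal set of positive diameter\<close>

lemma weak_limit_scaled_diff:
  fixes z :: "nat \<Rightarrow> 'a::real_normed_vector"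
  assumes "weak_limit z y"
  shows "weak_limit (\<lambda>n. c *\<^sub>R (z n - y)) 0"
  unfolding weak_limit_def
proof (intro allI impI)
  fix f :: "'a \<Rightarrow> real" assume f: "bounded_linear f"
  interpret bounded_linear f by (rule f)
  have "(\<lambda>n. f (z n)) \<longlonglongrightarrow> f y" using assms f by (simp add: weak_limit_def)
  then have "(\<lambda>n. c * (f (z n) - f y)) \<longlonglongrightarrow> c * (f y - f y)"
    by (intro tendsto_intros)
  then show "(\<lambda>n. f (c *\<^sub>R (z n - y))) \<longlonglongrightarrow> f 0" by (simp add: scaleR diff zero)
qed

lemma minimal_invariant_separated_tuple:
  fixes C :: "'a::banach set"
  assumes C: "weakly_compact C" and cm: "cm_nonexpansive C T" and KC: "K \<subseteq> C"
    and K: "minimal_invariant T K" and d: "0 < diameter K"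
    and k: "1 \<le> k" and e: "0 < e" "e \<le> 1"
  obtains v :: "nat \<Rightarrow> 'a" where "sep_tuple k (2 - 4 * e) v"
    "1 - 2 * e \<le> norm ((1 / real (k + 1)) *\<^sub>R (\<Sum>i\<le>k. v i))"
proof -
  note minK = minimal_invariantD[OF K]
  have bK: "bounded K" using weakly_compact_imp_bounded[OF C] KC by (rule bounded_subset)
  have ne: "nonexpansive_on K T"
    using cm KC minK(4) by (auto simp: cm_nonexpansive_def intro: nonexpansive_on_subset)
  define d where "d = diameter K"
  have d0: "0 < d" using d by (simp add: d_def)
  have diam: "norm (x - y) \<le> d" if "x \<in> K" "y \<in> K" for x y
    using diameter_bounded_bound[OF bK that] by (simp add: d_def dist_norm)
  have weak_in_K: "y \<in> K" if "weak_limit x y" "\<And>n. x n \<in> K" for x y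
    using that minK(2,3) by (intro weak_limit_in_closed_convex[of x]) auto
  obtain w0 where w0_range: "range w0 \<subseteq> K" and w0_lim: "(\<lambda>n. norm (T (w0 n) - w0 n)) \<longlonglongrightarrow> 0"
    by (rule approximate_fixed_points[OF minK(2,3,1) bK ne])
  have w0: "w0 n \<in> K" for n using w0_range by blast
  obtain p s0 where p: "strict_mono s0" "weak_limit (\<lambda>n. w0 (s0 n)) p"
    by (rule weakly_compact_imp_weak_subseq[OF C subsetD[OF KC w0]])
  define w where "w n = w0 (s0 n)" for n
  have w: "w n \<in> K" for n using w0 by (simp add: w_def)
  have wT: "(\<lambda>n. norm (T (w n) - w n)) \<longlonglongrightarrow> 0"
    unfolding w_def using LIMSEQ_subseq_LIMSEQ[OF w0_lim p(1)] by (simp add: o_def)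
  have wp: "weak_limit w p" using p(2) by (simp add: w_def[abs_def])
  have pK: "p \<in> K" using weak_in_K[OF wp w] .
  \<comment> \<open>Scaling by \<open>2 / d\<close> turns the error \<open>e'\<close> into
    \<open>e\<close>. The bound \<open>e' \<le> d\<close> later disposes of the proper subsets of a
    window.\<close>
  define e' where "e' = e * d / 2"
  have e': "0 < e'" "e' \<le> d" using e d0 by (auto simp: e'_def)
  obtain \<tau> where \<tau>: "0 < \<tau>" and
    windows: "\<And>u. (\<And>i::nat. u i \<in> K) \<Longrightarrow> (\<And>i. norm (T (u i) - u i) \<le> \<tau>) \<Longrightarrow>
      \<not> eventually (\<lambda>i. subset_sum_sup k u p i \<le> real k * d - e') sequentially"
    unfolding d_def using minimal_invariant_window_sums[OF C cm KC K k e'(1) pK] by metis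
  \<comment> \<open>This \<open>t\<close> makes the displacement bound \<open>t * d\<close> of the
    resolvents at most \<open>\<tau>\<close>, while keeping \<open>t < 1\<close>.\<close>
  define t where "t = min (1/2) (\<tau> / d)"
  have t: "0 < t" "t < 1" "t * d \<le> \<tau>" using \<tau> d0 by (auto simp: t_def min_def field_simps)
  \<comment> \<open>Midpoints halve distances: \<open>m i\<close> is within \<open>d / 2\<close> of
    \<open>m j\<close>, and \<open>m n\<close> within \<open>d / 2\<close> of \<open>w n\<close>.
    The resolvents inherit the first bound exactly and the second asymptotically.\<close>
  define m where "m n = (1/2) *\<^sub>R p + (1/2) *\<^sub>R w n" for n
  have mK: "m n \<in> K" for n unfolding m_def using pK w minK(3) by (intro convexD) auto
  have "\<forall>n. \<exists>z\<in>K. z = (1 - t) *\<^sub>R T z + t *\<^sub>R m n"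
    using resolvent_exists[OF minK(2,3) ne mK t(1,2)] by metis
  then obtain z0 where z0: "\<And>n. z0 n \<in> K" "\<And>n. z0 n = (1 - t) *\<^sub>R T (z0 n) + t *\<^sub>R m n" by metis
  have z0T: "norm (T (z0 n) - z0 n) \<le> \<tau>" for n
  proof -
    have "T (z0 n) \<in> K" using z0(1) minK(4) by blast
    then have "norm (T (z0 n) - z0 n) \<le> t * d"
      using resolvent_displacement[OF z0(2) t(1)] diam[OF _ mK] by blast
    then show ?thesis using t(3) by simp
  qed
  have z0d: "norm (z0 i - z0 j) \<le> d / 2" for i j
  proof -
    have "norm (z0 i - z0 j) \<le> norm (m i - m j)"
      by (rule resolvent_contracts[OF ne z0(1) z0(1) t(1,2) z0(2) z0(2)])
    also have "m i - m j = (1/2) *\<^sub>R (w i - w j)" by (simp add: m_def algebra_simps)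
    finally show ?thesis using diam[OF w w, of i j] by simp
  qed
  have z0w: "norm (z0 n - w n) \<le> d / 2 + norm (T (w n) - w n) / t" for n
  proof -
    have "m n - w n = (1/2) *\<^sub>R p + ((1/2) *\<^sub>R w n - w n)" by (simp add: m_def)
    also have "(1/2) *\<^sub>R w n - w n = - ((1/2) *\<^sub>R w n)"
      using scaleR_half_double[of "w n"] by (metis diff_eq_eq minus_diff_eq add_diff_cancel scaleR_right_distrib)
    finally have "m n - w n = (1/2) *\<^sub>R (p - w n)" by (simp add: algebra_simps)
    then have "norm (m n - w n) \<le> d / 2" using diam[OF pK w, of n] by simp
    then show ?thesis using resolvent_near[OF ne z0(1) w t(1,2) z0(2), of n n] by linarith
  qed
  obtain q s where s: "strict_mono s" "weak_limit (\<lambda>n. z0 (s n)) q"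
    by (rule weakly_compact_imp_weak_subseq[OF C subsetD[OF KC z0(1)]])
  define z where "z n = z0 (s n)" for n
  have zq: "weak_limit z q" using s(2) by (simp add: z_def[abs_def])
  have zK: "z n \<in> K" for n using z0(1) by (simp add: z_def)
  have z_near_q: "norm (z j - q) \<le> d / 2" for j
  proof -
    have "q \<in> cball (z j) (d / 2)"
      using z0d by (intro weak_limit_in_closed_convex[OF zq]) (auto simp: z_def dist_norm)
    then show ?thesis by (simp add: dist_norm)
  qed
  have q_near_p: "norm (q - p) \<le> d / 2"
  proof (rule field_le_epsilon)
    fix \<delta> :: real assume \<delta>: "0 < \<delta>"
    have "(\<lambda>n. norm (T (w (s n)) - w (s n)) / t) \<longlonglongrightarrow> 0 / t"
      using t LIMSEQ_subseq_LIMSEQ[OF wT s(1)] by (intro tendsto_divide) (auto simp: o_def)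
    then have "eventually (\<lambda>n. norm (T (w (s n)) - w (s n)) / t < \<delta>) sequentially"
      using \<delta> by (intro order_tendstoD(2)) auto
    \<comment> \<open>The differences \<open>z n - w (s n)\<close> converge weakly to
      \<open>q - p\<close>, so closed balls pass the bound to the limit.\<close>
    then have "eventually (\<lambda>n. z n - w (s n) \<in> cball 0 (d / 2 + \<delta>)) sequentially"
    proof eventually_elim
      case (elim n)
      then show ?case using z0w[of "s n"] by (simp add: z_def)
    qed
    then have "q - p \<in> cball 0 (d / 2 + \<delta>)"
      by (intro weak_limit_in_closed_convex[OF weak_limit_diff[OF zq weak_limit_subseq[OF wp s(1)]]])
        (auto intro: eventually_frequently)
    then show "norm (q - p) \<le> d / 2 + \<delta>" by simp
  qed
  define P where "P F \<longleftrightarrow> real k * d - e' < norm (\<Sum>j\<in>F. z j - p)" for F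
  obtain H where "H \<subseteq> UNIV" and H: "infinite H" and
    dich: "(\<forall>F. F \<subseteq> H \<and> finite F \<and> card F = k \<longrightarrow> P F) \<or> (\<forall>F. F \<subseteq> H \<and> finite F \<and> card F = k \<longrightarrow> \<not> P F)"
    by (rule Ramsey_dichotomy[OF infinite_UNIV_nat, of k P])
  have "\<not> (\<forall>F. F \<subseteq> H \<and> finite F \<and> card F = k \<longrightarrow> \<not> P F)"
  proof
    assume bad: "\<forall>F. F \<subseteq> H \<and> finite F \<and> card F = k \<longrightarrow> \<not> P F"
    define r where "r = enumerate H"
    have r: "strict_mono r" "\<And>n. r n \<in> H"
      unfolding r_def using H by (auto simp: strict_mono_enumerate enumerate_in_set)
    define u where "u i = z (r i)" for i
    \<comment> \<open>Enumerating \<open>H\<close> turns every full window into a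
      \<open>k\<close>-subset of \<open>H\<close>, so the bad colour bounds all window sums and
      contradicts \<open>windows\<close>.\<close>
    have "subset_sum_sup k u p i \<le> real k * d - e'" for i
      unfolding subset_sum_sup_le_iff
    proof (intro allI impI)
      fix A assume A: "A \<subseteq> {1..k}"
      show "norm (\<Sum>l\<in>A. u (i + l) - p) \<le> real k * d - e'"
      proof (cases "A = {1..k}")
        case True
        let ?g = "\<lambda>l. r (i + l)"
        have inj: "inj_on ?g A" using strict_mono_eq[OF r(1)] by (auto simp: inj_on_def)
        have "?g ` A \<subseteq> H" using r(2) by blast
        moreover have "finite (?g ` A)" using True by simp
        moreover have "card (?g ` A) = k" using card_image[OF inj] True by simp
        ultimately have "\<not> P (?g ` A)" using bad by blast
        then show ?thesis using sum.reindex[OF inj, of "\<lambda>j. z j - p"] by (simp add: P_def u_def)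
      next
        case False
        \<comment> \<open>A proper subset has at most \<open>k - 1\<close> terms of norm at most
          \<open>d\<close>, and \<open>(k - 1) * d \<le> k * d - e'\<close>.\<close>
        then have "card A < k" using A psubset_card_mono[of "{1..k}" A] by auto
        then have "real (card A) \<le> real k - 1" by linarith
        have "norm (\<Sum>l\<in>A. u (i + l) - p) \<le> real (card A) * d"
          using diam zK pK by (intro sum_norm_bound) (auto simp: u_def)
        also have "\<dots> \<le> (real k - 1) * d" using \<open>real (card A) \<le> real k - 1\<close> d0 by simp
        also have "\<dots> \<le> real k * d - e'" using e'(2) by (simp add: algebra_simps)
        finally show ?thesis .
      qed
    qed
    moreover have "u i \<in> K" "norm (T (u i) - u i) \<le> \<tau>" for i using zK z0T by (auto simp: u_def z_def)
    ultimately show False using windows[of u] by simp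
  qed
  then have good: "P F" if "F \<subseteq> H" "finite F" "card F = k" for F using dich that by blast
  define a where "a j = (2 / d) *\<^sub>R (z j - q)" for j
  define b where "b = (2 / d) *\<^sub>R (q - p)"
  have ab: "a j + b = (2 / d) *\<^sub>R (z j - p)" for j
    by (simp add: a_def b_def scaleR_add_right[symmetric])
  have unit: "norm ((2 / d) *\<^sub>R x) \<le> 1" if "norm x \<le> d / 2" for x :: 'a
    using that d0 by (simp add: field_simps)
  show ?thesis
  proof (rule separated_tuple_from_good_sums[OF k e(1), of a b H])
    show "weak_limit a 0" unfolding a_def[abs_def] by (rule weak_limit_scaled_diff[OF zq])
    show "norm (a j) \<le> 1" for j unfolding a_def by (rule unit[OF z_near_q])
    show "norm (a i - a j) \<le> 1" for i j
    proof -
      have "a i - a j = (2 / d) *\<^sub>R (z i - z j)" by (simp add: a_def scaleR_diff_right[symmetric])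
      then show ?thesis using unit[of "z i - z j"] z0d[of "s i" "s j"] by (simp add: z_def)
    qed
    show "norm b \<le> 1" unfolding b_def by (rule unit[OF q_near_p])
    show "infinite H" by (rule H)
    show "2 * real k - e \<le> norm (\<Sum>j\<in>F. a j + b)" if "F \<subseteq> H" "finite F" "card F = k" for F
    proof -
      have "2 * real k - e = (2 / d) * (real k * d - e')" using d0 by (simp add: e'_def field_simps)
      also have "\<dots> \<le> (2 / d) * norm (\<Sum>j\<in>F. z j - p)"
        using good[OF that] d0 by (intro mult_left_mono) (auto simp: P_def)
      also have "\<dots> = norm (\<Sum>j\<in>F. a j + b)"
        using d0 by (simp add: ab scaleR_sum_right[symmetric])
      finally show ?thesis .
    qed
  qed (rule that)
qed

section \<open>Unpacking the condition on \<open>eps0_k\<close>, and the conclusion\<close>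

lemma sep_tuple_mono: "sep_tuple k \<epsilon>' x \<Longrightarrow> \<epsilon> \<le> \<epsilon>' \<Longrightarrow> sep_tuple k \<epsilon> x"
  unfolding sep_tuple_def by (meson order_trans)

lemma norm_average_sep_tuple:
  assumes "sep_tuple k \<epsilon> x"
  shows "norm ((1 / real (k + 1)) *\<^sub>R (\<Sum>i\<le>k. x i)) \<le> 1"
proof -
  have "norm (\<Sum>i\<le>k. x i) \<le> (\<Sum>i\<le>k. 1)"
    using assms by (intro sum_norm_le) (auto simp: sep_tuple_def)
  then show ?thesis by (simp add: field_simps)
qed

text \<open>If \<open>s_k < 2\<close>, no tuple is separated by an \<open>\<epsilon>\<close>
  strictly between \<open>s_k\<close> and 2, and the bound is vacuous. If \<open>s_k = 2\<close>,
  any \<open>\<epsilon>\<close> strictly between \<open>max 0 eps0_k\<close> and 2 has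
  \<open>delta_k\<close> nonzero, hence positive, and \<open>\<delta>\<close> is that value.\<close>

lemma eps0_k_less_2_imp_average_bound:
  assumes k: "k \<ge> 1" and eps: "eps0_k TYPE('a::real_normed_vector) k < 2"
  obtains \<epsilon> \<delta> where "\<epsilon> < 2" "0 < \<delta>"
    "\<And>x :: nat \<Rightarrow> 'a. sep_tuple k \<epsilon> x \<Longrightarrow> norm ((1 / real (k + 1)) *\<^sub>R (\<Sum>i\<le>k. x i)) \<le> 1 - \<delta>"
proof -
  let ?S = "{\<epsilon> \<in> {0..2}. \<exists>x :: nat \<Rightarrow> 'a. sep_tuple k \<epsilon> x}"
  let ?E = "{\<epsilon>. 0 \<le> \<epsilon> \<and> \<epsilon> < s_k TYPE('a) k \<and> delta_k TYPE('a) k \<epsilon> = 0}"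
  have bddS: "bdd_above ?S" by (rule bdd_aboveI[of _ 2]) auto
  have "sep_tuple k 0 (\<lambda>_. 0 :: 'a)" by (simp add: sep_tuple_def)
  then have zero: "0 \<in> ?S" by auto
  then have s0: "0 \<le> s_k TYPE('a) k" unfolding s_k_def by (rule cSup_upper[OF _ bddS])
  have "s_k TYPE('a) k \<le> 2" unfolding s_k_def by (rule cSup_least) (use zero in blast, auto)
  note s = s0 this
  show ?thesis
  proof (cases "s_k TYPE('a) k < 2")
    case True
    then obtain \<epsilon> where \<epsilon>: "s_k TYPE('a) k < \<epsilon>" "\<epsilon> < 2" using dense by blast
    have "\<not> sep_tuple k \<epsilon> x" for x :: "nat \<Rightarrow> 'a"
    proof
      assume "sep_tuple k \<epsilon> x"
      then have "\<epsilon> \<in> ?S" using \<epsilon> s by auto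
      then have "\<epsilon> \<le> s_k TYPE('a) k" unfolding s_k_def by (rule cSup_upper[OF _ bddS])
      then show False using \<epsilon> by simp
    qed
    then show ?thesis using that[of \<epsilon> 1] \<epsilon> by auto
  next
    case False
    then have s2: "s_k TYPE('a) k = 2" using s by simp
    obtain \<epsilon> where \<epsilon>: "max 0 (eps0_k TYPE('a) k) < \<epsilon>" "\<epsilon> < 2"
      using dense[of "max 0 (eps0_k TYPE('a) k)" 2] eps by auto
    have "\<epsilon> \<notin> ?E"
    proof
      assume "\<epsilon> \<in> ?E"
      moreover have "bdd_above ?E" by (rule bdd_aboveI[of _ 2]) (use s2 in auto)
      ultimately have "\<epsilon> \<le> eps0_k TYPE('a) k" unfolding eps0_k_def by (rule cSup_upper)
      then show False using \<epsilon> by simp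
    qed
    then have nz: "delta_k TYPE('a) k \<epsilon> \<noteq> 0" using \<epsilon> s2 by auto
    let ?D = "{1 - norm ((1 / real (k + 1)) *\<^sub>R (\<Sum>i\<le>k. x i)) | x :: nat \<Rightarrow> 'a. sep_tuple k \<epsilon> x}"
    have pos: "0 \<le> y" if "y \<in> ?D" for y using that norm_average_sep_tuple by fastforce
    have bddD: "bdd_below ?D" using pos by (rule bdd_belowI)
    show ?thesis
    proof (cases "?D = {}")
      \<comment> \<open>Without tuples \<open>delta_k\<close> would be the \<open>Inf\<close> of the
        empty set; the required bound holds vacuously with the placeholder
        \<open>\<delta> = 1\<close>.\<close>
      case True
      then show ?thesis using that[of \<epsilon> 1] \<epsilon> by auto
    next
      case False
      then have "0 \<le> delta_k TYPE('a) k \<epsilon>" unfolding delta_k_def using pos by (intro cInf_greatest)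
      then have "0 < delta_k TYPE('a) k \<epsilon>" using nz by simp
      moreover have "norm ((1 / real (k + 1)) *\<^sub>R (\<Sum>i\<le>k. x i)) \<le> 1 - delta_k TYPE('a) k \<epsilon>"
        if "sep_tuple k \<epsilon> x" for x :: "nat \<Rightarrow> 'a"
      proof -
        have "delta_k TYPE('a) k \<epsilon> \<le> 1 - norm ((1 / real (k + 1)) *\<^sub>R (\<Sum>i\<le>k. x i))"
          unfolding delta_k_def using that by (intro cInf_lower bddD) blast
        then show ?thesis by simp
      qed
      ultimately show ?thesis using that \<epsilon>(2) by blast
    qed
  qed
qed

theorem theorem5p1:
  fixes k :: nat
  assumes "k \<ge> 1"
    and "eps0_k TYPE('a::banach) k < 2"
  shows "\<forall>C :: 'a set. C \<noteq> {} \<and> weakly_compact C \<and> convex C \<longrightarrow>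
           (\<forall>T. cm_nonexpansive C T \<longrightarrow> (\<exists>x\<in>C. T x = x))"
proof (intro allI impI, elim conjE)
  fix C :: "'a set" and T
  assume C: "C \<noteq> {}" "weakly_compact C" "convex C" and cm: "cm_nonexpansive C T"
  have "T ` C \<subseteq> C" using cm by (simp add: cm_nonexpansive_def nonexpansive_on_def)
  then obtain K where K: "K \<subseteq> C" "minimal_invariant T K"
    using minimal_invariant_exists[OF C(2,3,1)] by blast
  note minK = minimal_invariantD[OF K(2)]
  have bK: "bounded K" using weakly_compact_imp_bounded[OF C(2)] K(1) by (rule bounded_subset)
  have "\<not> 0 < diameter K"
  proof
    assume d: "0 < diameter K"
    obtain \<epsilon> \<delta> where \<epsilon>: "\<epsilon> < 2" "0 < \<delta>" and
      avg: "\<And>x :: nat \<Rightarrow> 'a. sep_tuple k \<epsilon> x \<Longrightarrow> norm ((1 / real (k + 1)) *\<^sub>R (\<Sum>i\<le>k. x i)) \<le> 1 - \<delta>"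
      using eps0_k_less_2_imp_average_bound[OF assms] by metis
    \<comment> \<open>The three entries secure \<open>e \<le> 1\<close>, the separation
      \<open>2 - 4 * e \<ge> \<epsilon>\<close>, and \<open>2 * e < \<delta>\<close>, so that the
      average norm \<open>1 - 2 * e\<close> exceeds \<open>1 - \<delta>\<close>.\<close>
    define e where "e = min 1 (min ((2 - \<epsilon>) / 4) (\<delta> / 4))"
    have e: "0 < e" "e \<le> 1" "\<epsilon> \<le> 2 - 4 * e" "2 * e < \<delta>"
    proof -
      have "e \<le> (2 - \<epsilon>) / 4" "e \<le> \<delta> / 4" "e \<le> 1"
        unfolding e_def by (rule min.coboundedI2 min.cobounded1 min.cobounded2 order_refl)+
      then show "e \<le> 1" "\<epsilon> \<le> 2 - 4 * e" "2 * e < \<delta>" using \<epsilon> by auto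
      show "0 < e" using \<epsilon> by (simp add: e_def)
    qed
    obtain v :: "nat \<Rightarrow> 'a" where v: "sep_tuple k (2 - 4 * e) v"
      "1 - 2 * e \<le> norm ((1 / real (k + 1)) *\<^sub>R (\<Sum>i\<le>k. v i))"
      by (rule minimal_invariant_separated_tuple[OF C(2) cm K d assms(1) e(1,2)])
    show False using avg[OF sep_tuple_mono[OF v(1) e(3)]] v(2) e(4) by linarith
  qed
  obtain x where x: "x \<in> K" using minK(1) by blast
  then have "T x \<in> K" using minK(4) by blast
  then have "dist (T x) x \<le> diameter K" using diameter_bounded_bound[OF bK _ x] by blast
  then have "dist (T x) x \<le> 0" using \<open>\<not> 0 < diameter K\<close> by linarith
  then have "T x = x" by simp
  then show "\<exists>x\<in>C. T x = x" using x K(1) by blast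
qed

end
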